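(* Let $P\in\mathfrak{P}_+$ be fixed, and let $f^p: \mathfrak{P}_+ \rightarrow \mathfrak{C}_+$ be the map from $Q$ to $c$ given component-wise by $$c_{\mathbf{k}} = \int_{\mathbb{T}^d} e^{i (\mathbf{k}, \boldsymbol{\theta})} \frac{P}{Q}\, dm, \quad \mathbf{k}\in\Lambda.$$ If $d\leq 2$, then $f^p$ is a diffeomorphism.
   Context: Let $d\ge 1$, $\mathbb{T}=(-\pi,\pi]$, $\boldsymbol{\theta}=(\theta_1,\dots,\theta_d)$, $e^{i\boldsymbol{\theta}}=(e^{i\theta_1},\dots,e^{i\theta_d})$, $(\mathbf{k},\boldsymbol{\theta})=\sum_{j=1}^d k_j\theta_j$, and $dm(\boldsymbol{\theta})=(1/2\pi)^d\prod_{j=1}^d d\theta_j$. The index set $\Lambda\subset\mathbb{Z}^d$ is finite with $0\in\Lambda$ and $-\Lambda=\Lambda$. Trigonometric polynomials are $P(e^{i\boldsymbol{\theta}})=\sum_{\mathbf{k}\in\Lambda}p_{\mathbf{k}}e^{-i(\mathbf{k},\boldsymbol{\theta})}$ with $p_{-\mathbf{k}}=\bar p_{\mathbf{k}}$ (real valued), identified with their coefficient vector $p=(p_{\mathbf{k}})_{\mathbf{k}\in\Lambda}$ (similarly $Q\leftrightarrow q$). $\mathfrak{P}_+$ is the convex cone of such polynomials that are positive for all $\boldsymbol{\theta}\in\mathbb{T}^d$; $\bar{\mathfrak{P}}_+$ is its closure. Sequences $c=(c_{\mathbf{k}})_{\mathbf{k}\in\Lambda}$ are complex with $c_{-\mathbf{k}}=\bar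 c_{\mathbf{k}}$; $\langle c,p\rangle=\sum_{\mathbf{k}\in\Lambda}c_{\mathbf{k}}\bar p_{\mathbf{k}}$. $\mathfrak{C}_+=\{c\mid\langle c,p\rangle>0\text{ for all }P\in\bar{\mathfrak{P}}_+\setminus\{0\}\}$. Both $\mathfrak{P}_+$ and $\mathfrak{C}_+$ are regarded as open subsets of the real vector space $\{(r_{\mathbf{k}})_{\mathbf{k}\in\Lambda}\in\mathbb{C}^{|\Lambda|}\mid r_{-\mathbf{k}}=\bar r_{\mathbf{k}}\}\cong\mathbb{R}^{|\Lambda|}$. *)

theory Defs
  imports "HOL-Analysis.Analysis"
begin

text \<open>
  The finite index set \<open>\<Lambda>\<close> of the moment problem is enumerated without repetition by a map
  \<open>\<kappa> :: 'n::finite \<Rightarrow> int ^ 'd\<close> with range \<open>\<Lambda>\<close>; a family indexed by \<open>\<Lambda>\<close> is then a vector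
  \<open>r :: complex ^ 'n\<close>, whose component \<open>r $ i\<close> is the entry with multi-index \<open>\<kappa> i\<close>.
\<close>

definition herm_space :: "('n::finite \<Rightarrow> int ^ 'd::finite) \<Rightarrow> (complex ^ 'n) set" where
  "herm_space \<kappa> = {r. \<forall>i j. \<kappa> j = - \<kappa> i \<longrightarrow> r $ j = cnj (r $ i)}"

definition torus :: "(real ^ 'd::finite) set" where
  "torus = {\<theta>. \<forall>j. - pi < \<theta> $ j \<and> \<theta> $ j \<le> pi}"

definition freq_pairing :: "int ^ 'd::finite \<Rightarrow> real ^ 'd \<Rightarrow> real" where
  "freq_pairing k \<theta> = (\<Sum>j\<in>UNIV. of_int (k $ j) * \<theta> $ j)"

definition trig_poly ::
    "('n::finite \<Rightarrow> int ^ 'd::finite) \<Rightarrow> complex ^ 'n \<Rightarrow> real ^ 'd \<Rightarrow> complex" where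
  "trig_poly \<kappa> p \<theta> =
     (\<Sum>i\<in>UNIV. p $ i * exp (- (\<i> * complex_of_real (freq_pairing (\<kappa> i) \<theta>))))"

text \<open>
  The real parts in \<open>pos_cone\<close> and \<open>dual_cone\<close> only convert the type: for vectors in
  \<open>herm_space \<kappa>\<close> the complex values are real, by \<open>trig_poly_real\<close> and \<open>coeff_pairing_real\<close> below.
\<close>

definition pos_cone :: "('n::finite \<Rightarrow> int ^ 'd::finite) \<Rightarrow> (complex ^ 'n) set" where
  "pos_cone \<kappa> = {p \<in> herm_space \<kappa>. \<forall>\<theta>\<in>torus. 0 < Re (trig_poly \<kappa> p \<theta>)}"

definition coeff_pairing :: "complex ^ 'n::finite \<Rightarrow> complex ^ 'n \<Rightarrow> complex" where
  "coeff_pairing c p = (\<Sum>i\<in>UNIV. c $ i * cnj (p $ i))"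

definition dual_cone :: "('n::finite \<Rightarrow> int ^ 'd::finite) \<Rightarrow> (complex ^ 'n) set" where
  "dual_cone \<kappa> =
     {c \<in> herm_space \<kappa>. \<forall>p \<in> closure (pos_cone \<kappa>) - {0}. 0 < Re (coeff_pairing c p)}"

text \<open>The factor in front of the integral is the normalisation of the measure \<open>dm\<close>.\<close>

definition moment_map ::
    "('n::finite \<Rightarrow> int ^ 'd::finite) \<Rightarrow> complex ^ 'n \<Rightarrow> complex ^ 'n \<Rightarrow> complex ^ 'n" where
  "moment_map \<kappa> p q =
     (\<chi> i. ((1 / (2 * pi)) ^ CARD('d)) *\<^sub>R
        (LINT \<theta>:torus|lborel.
           exp (\<i> * complex_of_real (freq_pairing (\<kappa> i) \<theta>)) *
           (trig_poly \<kappa> p \<theta> / trig_poly \<kappa> q \<theta>)))"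

text \<open>
  \<open>Ck_on V n U f\<close>: \<open>f\<close> is n times continuously differentiable on \<open>U\<close>, where \<open>U\<close> is meant to
  be relatively open in the real subspace \<open>V\<close>.  The derivative within \<open>U\<close> is then
  determined exactly on \<open>V\<close>, so only directions in \<open>V\<close> are differentiated further.
\<close>

primrec Ck_on ::
    "'a::real_normed_vector set \<Rightarrow> nat \<Rightarrow> 'a set \<Rightarrow> ('a \<Rightarrow> 'b::real_normed_vector) \<Rightarrow> bool" where
  "Ck_on V 0 U f = continuous_on U f"
| "Ck_on V (Suc n) U f =
     (\<exists>f'. (\<forall>x\<in>U. (f has_derivative f' x) (at x within U)) \<and>
           (\<forall>v\<in>V. Ck_on V n U (\<lambda>x. f' x v)))"

definition smooth_on ::
    "'a::real_normed_vector set \<Rightarrow> 'a set \<Rightarrow> ('a \<Rightarrow> 'b::real_normed_vector) \<Rightarrow> bool" where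
  "smooth_on V U f \<longleftrightarrow> (\<forall>n. Ck_on V n U f)"

definition diffeomorphism ::
    "'a::real_normed_vector set \<Rightarrow> 'a set \<Rightarrow> 'a set \<Rightarrow> ('a \<Rightarrow> 'a) \<Rightarrow> bool" where
  "diffeomorphism V U W f \<longleftrightarrow>
     openin (top_of_set V) U \<and> openin (top_of_set V) W \<and>
     bij_betw f U W \<and> smooth_on V U f \<and> smooth_on V W (inv_into U f)"

lemma subspace_herm_space: "subspace (herm_space \<kappa>)"
  by (auto simp: subspace_def herm_space_def)

lemma reflect_bij:
  fixes \<kappa> :: "'n::finite \<Rightarrow> int ^ 'd::finite"
  assumes "inj \<kappa>" and "uminus ` range \<kappa> = range \<kappa>"
  obtains s where "bij s" and "\<And>i. \<kappa> (s i) = - \<kappa> i"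
proof -
  have "\<forall>i. \<exists>j. \<kappa> j = - \<kappa> i"
  proof
    fix i
    have "- \<kappa> i \<in> range \<kappa>" using assms(2) by blast
    then show "\<exists>j. \<kappa> j = - \<kappa> i" by (metis imageE)
  qed
  then obtain s where s: "\<And>i. \<kappa> (s i) = - \<kappa> i" by metis
  have "s (s i) = i" for i
    using s assms(1) by (metis inj_eq minus_minus)
  then have "bij s" by (metis involuntory_imp_bij)
  with s show thesis by (rule that[rotated])
qed

lemma trig_poly_real:
  fixes \<kappa> :: "'n::finite \<Rightarrow> int ^ 'd::finite"
  assumes "inj \<kappa>" and "uminus ` range \<kappa> = range \<kappa>" and "p \<in> herm_space \<kappa>"
  shows "trig_poly \<kappa> p \<theta> \<in> \<real>"
proof -
  obtain s where s: "bij s" "\<And>i. \<kappa> (s i) = - \<kappa> i" using reflect_bij assms(1,2) by blast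
  have p: "p $ s i = cnj (p $ i)" for i using assms(3) s(2) by (auto simp: herm_space_def)
  have m: "freq_pairing (\<kappa> (s i)) \<theta> = - freq_pairing (\<kappa> i) \<theta>" for i
    by (simp add: s(2) freq_pairing_def sum_negf)
  have "trig_poly \<kappa> p \<theta> =
    (\<Sum>i\<in>UNIV. p $ s i * exp (- (\<i> * complex_of_real (freq_pairing (\<kappa> (s i)) \<theta>))))"
    unfolding trig_poly_def by (rule sum.reindex_bij_betw[OF s(1), symmetric])
  also have "\<dots> = cnj (trig_poly \<kappa> p \<theta>)"
    by (simp add: p m trig_poly_def exp_cnj)
  finally show ?thesis by (simp add: Reals_cnj_iff)
qed

lemma coeff_pairing_real:
  fixes \<kappa> :: "'n::finite \<Rightarrow> int ^ 'd::finite"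
  assumes "inj \<kappa>" and "uminus ` range \<kappa> = range \<kappa>"
    and "c \<in> herm_space \<kappa>" and "p \<in> herm_space \<kappa>"
  shows "coeff_pairing c p \<in> \<real>"
proof -
  obtain s where s: "bij s" "\<And>i. \<kappa> (s i) = - \<kappa> i" using reflect_bij assms(1,2) by blast
  have r: "c $ s i = cnj (c $ i)" "p $ s i = cnj (p $ i)" for i
    using assms(3,4) s(2) by (auto simp: herm_space_def)
  have "coeff_pairing c p = (\<Sum>i\<in>UNIV. c $ s i * cnj (p $ s i))"
    unfolding coeff_pairing_def by (rule sum.reindex_bij_betw[OF s(1), symmetric])
  also have "\<dots> = cnj (coeff_pairing c p)"
    by (simp add: r coeff_pairing_def)
  finally show ?thesis by (simp add: Reals_cnj_iff)
qed

end

theory Submission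
  imports Defs
begin

text \<open>
  For a real trigonometric polynomial \<open>R\<close> one has \<open>\<langle>f(Q), R\<rangle> = \<integral> (P / Q) R dm\<close>. This gives \<open>f(Q) \<in> dual_cone\<close>, the
  strict monotonicity \<open>\<langle>f(Q) - f(Q'), Q' - Q\<rangle> = \<integral> P (Q - Q')\<^sup>2 / (Q Q') dm > 0\<close>, hence injectivity, and
  in the same way the injectivity of the Jacobian. By invariance of domain the image is open.
  It is also relatively closed in the dual cone: a bound on \<open>f(Q)\<close> near a point of the dual cone
  bounds \<open>Q\<close>, because \<open>\<langle>f(Q), Q\<rangle> = \<integral> P dm\<close>, and it bounds \<open>\<integral> P / Q dm\<close>. Since \<open>Q\<close> grows at most
  quadratically away from a minimum and \<open>\<bar>\<theta>\<bar>\<^sup>-\<^sup>2\<close> is not integrable at 0 in dimension at most 2, \<open>Q\<close> then stays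
  uniformly away from 0. The dual cone is convex, hence connected, so \<open>f\<close> is onto.
\<close>

section \<open>Trigonometric polynomials on the torus\<close>

text \<open>Quadratic growth is critical in dimension 2: around a near-zero of Q, the cube of side
  2^-j contributes about 4^j * 2^(-j d) to the integral of 1/Q, and these contributions stay bounded
  below exactly when d <= 2. Counting dyadic scales makes this quantitative, so a limit polynomial
  on the boundary of the cone never has to be examined. For d >= 3 the contributions are summable,
  and bounded moments no longer keep Q away from 0.

  Both cones lie in a proper real subspace of C^n, so derivatives are taken within the cones.
  Smoothness of the inverse is obtained in three stages: continuity from invariance of domain, one
  derivative from a remainder estimate, and all higher ones from an algebra of functions closed
  under differentiation. The Jacobian is treated as a complex matrix on all of C^n, which makes
  determinants and Cramer's rule available.\<close>

abbreviation cube :: "(real ^ 'd::finite) set" where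
  "cube \<equiv> cbox (\<chi> j. - pi) (\<chi> j. pi)"

text \<open>Carries the minus sign of \<open>trig_poly\<close>; the kernel of
  \<open>moment_map\<close> is therefore the conjugate of \<open>chr\<close>.\<close>

definition chr :: "int ^ 'd::finite \<Rightarrow> real ^ 'd \<Rightarrow> complex" where
  "chr k \<theta> = exp (- (\<i> * complex_of_real (freq_pairing k \<theta>)))"

lemma chr_eq_cis: "chr k \<theta> = cis (- freq_pairing k \<theta>)"
  by (simp add: chr_def cis_conv_exp)

lemma cis_minus_multiple: "cis (- (of_int n * (2 * pi))) = 1"
  using cis_multiple_2pi[of "- of_int n"] by (simp add: algebra_simps)

lemma trig_poly_chr: "trig_poly \<kappa> p \<theta> = (\<Sum>i\<in>UNIV. p $ i * chr (\<kappa> i) \<theta>)"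
  by (simp add: trig_poly_def chr_def)

lemma exp_eq_cnj_chr: "exp (\<i> * complex_of_real (freq_pairing k \<theta>)) = cnj (chr k \<theta>)"
  by (simp add: chr_def exp_cnj)

lemma freq_pairing_add: "freq_pairing k (\<theta> + \<phi>) = freq_pairing k \<theta> + freq_pairing k \<phi>"
  by (simp add: freq_pairing_def algebra_simps sum.distrib)

lemma freq_pairing_diff: "freq_pairing k (\<theta> - \<phi>) = freq_pairing k \<theta> - freq_pairing k \<phi>"
  by (simp add: freq_pairing_def algebra_simps sum_subtractf)

lemma chr_add: "chr k (\<theta> + \<phi>) = chr k \<theta> * chr k \<phi>"
  by (simp add: chr_def freq_pairing_add algebra_simps flip: exp_add)

lemma norm_chr [simp]: "norm (chr k \<theta>) = 1"
  by (simp add: chr_def)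

lemma chr_nonzero [simp]: "chr k \<theta> \<noteq> 0"
  by (simp add: chr_def)

lemma chr_0 [simp]: "chr 0 \<theta> = 1"
  by (simp add: chr_def freq_pairing_def)

lemma continuous_on_freq_pairing [continuous_intros]: "continuous_on S (freq_pairing k)"
  unfolding freq_pairing_def by (intro continuous_intros)

lemma continuous_on_chr [continuous_intros]: "continuous_on S (chr k)"
  unfolding chr_def by (intro continuous_intros)

lemma continuous_on_trig_poly [continuous_intros]: "continuous_on S (trig_poly \<kappa> p)"
  unfolding trig_poly_chr by (intro continuous_intros)

lemma norm_trig_poly_le: "norm (trig_poly \<kappa> p \<theta>) \<le> (\<Sum>i\<in>UNIV. norm (p $ i))"
  unfolding trig_poly_chr by (rule order_trans[OF norm_sum]) (simp add: norm_mult)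

lemma norm_trig_poly_le_card:
  fixes p :: "complex ^ 'n::finite"
  shows "norm (trig_poly \<kappa> p \<theta>) \<le> CARD('n) * norm p"
proof -
  have "(\<Sum>i\<in>UNIV. norm (p $ i)) \<le> (\<Sum>i\<in>(UNIV::'n set). norm p)"
    by (intro sum_mono) (rule Finite_Cartesian_Product.norm_nth_le)
  with norm_trig_poly_le[of \<kappa> p \<theta>] show ?thesis by simp
qed

lemma trig_poly_add: "trig_poly \<kappa> (p + q) \<theta> = trig_poly \<kappa> p \<theta> + trig_poly \<kappa> q \<theta>"
  by (simp add: trig_poly_def algebra_simps sum.distrib)

lemma trig_poly_diff: "trig_poly \<kappa> (p - q) \<theta> = trig_poly \<kappa> p \<theta> - trig_poly \<kappa> q \<theta>"
  by (simp add: trig_poly_def algebra_simps sum_subtractf)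

lemma trig_poly_scaleR: "trig_poly \<kappa> (c *\<^sub>R p) \<theta> = c *\<^sub>R trig_poly \<kappa> p \<theta>"
  by (simp add: trig_poly_def scaleR_sum_right)

lemma bounded_linear_trig_poly: "bounded_linear (\<lambda>q. trig_poly \<kappa> q \<theta>)"
  unfolding linear_conv_bounded_linear[symmetric]
  by (rule linearI) (simp_all add: trig_poly_add trig_poly_scaleR)

lemma chr_periodic:
  assumes "\<And>j. \<theta>' $ j = \<theta> $ j - 2 * pi * of_int (m $ j)"
  shows "chr k \<theta>' = chr k \<theta>"
proof -
  have "\<theta> = \<theta>' + (\<chi> j. 2 * pi * of_int (m $ j))"
    by (simp add: vec_eq_iff assms)
  moreover have "chr k (\<chi> j. 2 * pi * of_int (m $ j)) = 1"
  proof -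
    have "freq_pairing k (\<chi> j. 2 * pi * of_int (m $ j)) = of_int (\<Sum>j\<in>UNIV. k $ j * m $ j) * (2 * pi)"
      by (simp add: freq_pairing_def sum_distrib_right sum_distrib_left algebra_simps)
    then show ?thesis
      unfolding chr_eq_cis by (simp only: cis_minus_multiple)
  qed
  ultimately show ?thesis by (simp add: chr_add)
qed

text \<open>\<open>pos_cone\<close> constrains values on \<open>torus\<close> only. Periodicity
  carries positivity to the whole space, which is needed at the shifted points \<theta> + h and
  \<theta> - h and on the closed faces of \<open>cube\<close>.\<close>

lemma torus_representative:
  obtains \<theta>' where "\<theta>' \<in> torus" and "\<And>k. chr k \<theta>' = chr k \<theta>"
proof -
  \<comment> \<open>The ceiling, not the floor, because \<open>torus\<close> is open at - pi and
    closed at pi.\<close>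
  define m where "m = (\<chi> j. \<lceil>(\<theta> $ j - pi) / (2 * pi)\<rceil>)"
  define \<theta>' where "\<theta>' = (\<chi> j. \<theta> $ j - 2 * pi * of_int (m $ j))"
  have "\<theta>' \<in> torus"
  proof -
    have "- pi < \<theta> $ j - 2 * pi * of_int (m $ j) \<and> \<theta> $ j - 2 * pi * of_int (m $ j) \<le> pi" for j
    proof -
      have "(\<theta> $ j - pi) / (2 * pi) \<le> of_int (m $ j)" "of_int (m $ j) < (\<theta> $ j - pi) / (2 * pi) + 1"
        unfolding m_def by (simp_all add: ceiling_less_iff) linarith
      then show ?thesis by (simp add: field_simps)
    qed
    then show ?thesis by (simp add: torus_def \<theta>'_def)
  qed
  moreover have "chr k \<theta>' = chr k \<theta>" for k
    by (rule chr_periodic) (simp add: \<theta>'_def)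
  ultimately show thesis by (rule that)
qed

lemma torus_subset_cube: "torus \<subseteq> cube"
  by (auto simp: torus_def mem_box_cart less_imp_le)

lemma trig_poly_torus:
  obtains \<theta>' where "\<theta>' \<in> torus" "trig_poly \<kappa> q \<theta>' = trig_poly \<kappa> q \<theta>"
  by (rule torus_representative[of \<theta>]) (simp add: trig_poly_chr)

section \<open>Linear independence of the characters\<close>

lemma chr_distinct:
  assumes "k \<noteq> l"
  obtains \<phi> where "chr k \<phi> \<noteq> chr l \<phi>"
proof -
  obtain m where m: "k $ m \<noteq> l $ m" using assms by (auto simp: vec_eq_iff)
  \<comment> \<open>With this t the two phases differ by exactly pi, so the character values are
    opposite.\<close>
  define t where "t = pi / of_int (k $ m - l $ m)"
  have fp: "freq_pairing h (axis m t) = of_int (h $ m) * t" for h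
    by (simp add: freq_pairing_def axis_def if_distrib cong: if_cong)
  have "freq_pairing k (axis m t) - freq_pairing l (axis m t) = pi"
  proof -
    have "freq_pairing k (axis m t) - freq_pairing l (axis m t) = of_int (k $ m - l $ m) * t"
      by (simp add: fp algebra_simps)
    with m show ?thesis by (simp add: t_def del: of_int_diff)
  qed
  then have "freq_pairing k (axis m t) = freq_pairing l (axis m t) + pi" by simp
  then have "chr k (axis m t) = - chr l (axis m t)"
    by (simp add: chr_eq_cis complex_eq_iff)
  then have "chr k (axis m t) \<noteq> chr l (axis m t)"
    using chr_nonzero[of l "axis m t"] by (simp add: complex_eq_iff)
  then show thesis by (rule that)
qed

text \<open>Artin's argument: shifting the argument by \<open>\<phi>\<close> multiplies each character by a scalar, which
  eliminates one term of a linear relation.\<close>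

lemma chr_independent:
  fixes \<kappa> :: "'n \<Rightarrow> int ^ 'd::finite"
  assumes "inj \<kappa>" "finite S" "\<And>\<theta>. (\<Sum>i\<in>S. a i * chr (\<kappa> i) \<theta>) = 0" "i \<in> S"
  shows "a i = 0"
  using assms(2-)
proof (induction S arbitrary: a i rule: finite_induct)
  case (insert j S)
  have rel: "(\<Sum>i\<in>S. a i * chr (\<kappa> i) \<theta>) + a j * chr (\<kappa> j) \<theta> = 0" for \<theta>
    using insert.prems(1)[of \<theta>] insert.hyps by (simp add: add.commute)
  have S0: "a i = 0" if "i \<in> S" for i
  proof -
    from insert.hyps that have "\<kappa> i \<noteq> \<kappa> j" using assms(1) by (auto dest: injD)
    then obtain \<phi> where \<phi>: "chr (\<kappa> i) \<phi> \<noteq> chr (\<kappa> j) \<phi>" by (rule chr_distinct)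
    have "(\<Sum>i\<in>S. (a i * (chr (\<kappa> i) \<phi> - chr (\<kappa> j) \<phi>)) * chr (\<kappa> i) \<theta>) = 0" for \<theta>
    proof -
      have "(\<Sum>i\<in>S. (a i * (chr (\<kappa> i) \<phi> - chr (\<kappa> j) \<phi>)) * chr (\<kappa> i) \<theta>)
        = ((\<Sum>i\<in>S. a i * chr (\<kappa> i) (\<theta> + \<phi>)) + a j * chr (\<kappa> j) (\<theta> + \<phi>))
        - chr (\<kappa> j) \<phi> * ((\<Sum>i\<in>S. a i * chr (\<kappa> i) \<theta>) + a j * chr (\<kappa> j) \<theta>)"
        by (simp add: chr_add algebra_simps sum_subtractf sum_distrib_left)
      then show ?thesis by (simp only: rel) simp
    qed
    then have "a i * (chr (\<kappa> i) \<phi> - chr (\<kappa> j) \<phi>) = 0"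
      using that by (rule insert.IH)
    with \<phi> show ?thesis by simp
  qed
  with rel[of 0] have "a j = 0" by simp
  with S0 insert.prems(2) show ?case by blast
qed simp

lemma trig_poly_eq_0:
  fixes \<kappa> :: "'n::finite \<Rightarrow> int ^ 'd::finite"
  assumes "inj \<kappa>" "\<And>\<theta>. \<theta> \<in> torus \<Longrightarrow> trig_poly \<kappa> r \<theta> = 0"
  shows "r = 0"
proof -
  have "trig_poly \<kappa> r \<theta> = 0" for \<theta>
    by (metis assms(2) trig_poly_torus)
  then have "(\<Sum>i\<in>UNIV. r $ i * chr (\<kappa> i) \<theta>) = 0" for \<theta>
    by (simp add: trig_poly_chr)
  then have "r $ i = 0" for i
    using chr_independent[OF assms(1), of UNIV "\<lambda>i. r $ i" i] by simp
  then show ?thesis by (simp add: vec_eq_iff)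
qed

text \<open>The two sets differ only by faces in the hyperplanes \<theta>_j = - pi. On the compact
  \<open>cube\<close>, continuity alone gives integrability, so all later integrals are taken
  there.\<close>

lemma torus_integral_eq:
  fixes g :: "real ^ 'd::finite \<Rightarrow> complex"
  assumes "continuous_on cube g"
  shows "(LINT \<theta>:torus|lborel. g \<theta>) = integral cube g"
proof -
  have m: "torus \<in> sets (lborel :: (real ^ 'd) measure)"
    unfolding torus_def by measurable
  have "set_integrable lborel cube g"
    unfolding set_integrable_def by (rule borel_integrable_compact) (use assms in auto)
  then have "set_integrable lborel torus g"
    by (rule set_integrable_subset) (use m torus_subset_cube in auto)
  then have "(LINT \<theta>:torus|lborel. g \<theta>) = integral torus g"
    by (rule set_borel_integral_eq_integral)
  also have "\<dots> = integral cube g"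
  proof (rule integral_subset_negligible[OF torus_subset_cube])
    have "cube - torus \<subseteq> (\<Union>j. {\<theta>::real^'d. axis j 1 \<bullet> \<theta> = - pi})"
      by (auto simp: torus_def mem_box_cart inner_axis' less_le)
    moreover have "negligible (\<Union>j. {\<theta>::real^'d. axis j 1 \<bullet> \<theta> = - pi})"
      by (intro negligible_Union finite_imageI) (auto intro!: negligible_hyperplane)
    ultimately show "negligible (cube - torus :: (real^'d) set)"
      by (rule negligible_subset[rotated])
  qed
  finally show ?thesis .
qed

lemma integral_cube_pos:
  fixes g :: "real ^ 'd::finite \<Rightarrow> real"
  assumes "continuous_on cube g" "\<And>\<theta>. \<theta> \<in> cube \<Longrightarrow> 0 \<le> g \<theta>" "\<theta>0 \<in> cube" "g \<theta>0 \<noteq> 0"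
  shows "0 < integral cube g"
proof -
  have "0 \<le> integral cube g"
    by (rule integral_nonneg) (use assms in \<open>auto intro: integrable_continuous\<close>)
  moreover have "box (\<chi> j. - pi) (\<chi> j. pi) \<noteq> ({} :: (real^'d) set)"
    by (simp add: interval_ne_empty_cart)
  then have "integral cube g \<noteq> 0"
    using integral_cbox_eq_0_iff[OF assms(1)] assms by blast
  ultimately show ?thesis by simp
qed

section \<open>The cones and the moment map\<close>

lemma Re_coeff_pairing: "Re (coeff_pairing c p) = c \<bullet> p"
  by (simp add: coeff_pairing_def inner_vec_def inner_complex_def)

text \<open>Common core of \<open>moment_map_inner\<close>, with f = P / Q, and of
  \<open>jac_injective\<close>, with f = P V / Q^2, where V is the polynomial with coefficient
  vector v.\<close>

lemma sum_integral_chr: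
  fixes f :: "real ^ 'd::finite \<Rightarrow> complex"
  assumes "continuous_on cube f"
  shows "(\<Sum>i\<in>UNIV. integral cube (\<lambda>\<theta>. cnj (chr (\<kappa> i) \<theta>) * f \<theta>) * cnj (r $ i)) =
    integral cube (\<lambda>\<theta>. f \<theta> * cnj (trig_poly \<kappa> r \<theta>))"
proof -
  have i: "(\<lambda>\<theta>. cnj (chr (\<kappa> i) \<theta>) * f \<theta>) integrable_on cube" for i
    by (intro integrable_continuous continuous_intros assms)
  have "(\<Sum>i\<in>UNIV. integral cube (\<lambda>\<theta>. cnj (chr (\<kappa> i) \<theta>) * f \<theta>) * cnj (r $ i)) =
    (\<Sum>i\<in>UNIV. integral cube (\<lambda>\<theta>. cnj (chr (\<kappa> i) \<theta>) * f \<theta> * cnj (r $ i)))"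
    by simp
  also have "\<dots> = integral cube (\<lambda>\<theta>. \<Sum>i\<in>UNIV. cnj (chr (\<kappa> i) \<theta>) * f \<theta> * cnj (r $ i))"
    by (rule integral_sum[symmetric]) (auto intro!: integrable_on_mult_left i)
  also have "\<dots> = integral cube (\<lambda>\<theta>. f \<theta> * cnj (trig_poly \<kappa> r \<theta>))"
    by (simp add: trig_poly_chr sum_distrib_left mult_ac)
  finally show ?thesis .
qed

lemma Re_integral:
  assumes "f integrable_on S"
  shows "Re (integral S f) = integral S (\<lambda>x. Re (f x))"
  using integral_linear[OF assms bounded_linear_Re] by (simp add: o_def)

section \<open>The two cones: openness, convexity, coercivity of the pairing\<close>

locale index_set =
  fixes \<kappa> :: "'n::finite \<Rightarrow> int ^ 'd::finite"
  assumes inj: "inj \<kappa>" and sym: "uminus ` range \<kappa> = range \<kappa>"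
begin

lemma of_real_Re_trig_poly:
  "q \<in> herm_space \<kappa> \<Longrightarrow> complex_of_real (Re (trig_poly \<kappa> q \<theta>)) = trig_poly \<kappa> q \<theta>"
  by (rule of_real_Re[OF trig_poly_real[OF inj sym]])

lemma pos_cone_herm: "q \<in> pos_cone \<kappa> \<Longrightarrow> q \<in> herm_space \<kappa>"
  by (simp add: pos_cone_def)

lemma pos_cone_pos:
  assumes "q \<in> pos_cone \<kappa>" shows "0 < Re (trig_poly \<kappa> q \<theta>)"
  by (rule trig_poly_torus[of \<kappa> q \<theta>]) (use assms in \<open>auto simp: pos_cone_def\<close>)

lemma pos_cone_nonzero:
  assumes "q \<in> pos_cone \<kappa>" shows "trig_poly \<kappa> q \<theta> \<noteq> 0"
  using pos_cone_pos[OF assms, of \<theta>] by auto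

lemma closed_herm_space: "closed (herm_space \<kappa>)"
  by (rule closed_subspace) (rule subspace_herm_space)

lemma continuous_on_trig_poly_coeff: "continuous_on S (\<lambda>q. trig_poly \<kappa> q \<theta>)"
  by (rule linear_continuous_on[OF bounded_linear_trig_poly])

lemma closure_pos_cone:
  assumes "q \<in> closure (pos_cone \<kappa>)"
  shows "q \<in> herm_space \<kappa>" and "0 \<le> Re (trig_poly \<kappa> q \<theta>)"
proof -
  have "closed (herm_space \<kappa> \<inter> {q. 0 \<le> Re (trig_poly \<kappa> q \<theta>)})"
    by (intro closed_Int closed_herm_space closed_Collect_le continuous_intros
        continuous_on_trig_poly_coeff)
  then have "closure (pos_cone \<kappa>) \<subseteq> herm_space \<kappa> \<inter> {q. 0 \<le> Re (trig_poly \<kappa> q \<theta>)}"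
    by (rule closure_minimal[rotated]) (auto simp: pos_cone_herm pos_cone_pos less_imp_le)
  with assms show "q \<in> herm_space \<kappa>" "0 \<le> Re (trig_poly \<kappa> q \<theta>)" by auto
qed

lemma pos_cone_lower_bound:
  assumes "q \<in> pos_cone \<kappa>"
  obtains m where "0 < m" "\<And>\<theta>. m \<le> Re (trig_poly \<kappa> q \<theta>)"
proof -
  have "(cube :: (real^'d) set) \<noteq> {}" by (simp add: interval_ne_empty_cart)
  then obtain \<theta>0 :: "real^'d" where \<theta>0: "\<forall>\<theta>\<in>cube. Re (trig_poly \<kappa> q \<theta>0) \<le> Re (trig_poly \<kappa> q \<theta>)"
    using continuous_attains_inf[OF compact_cbox, of "\<chi> j. - pi" "\<chi> j. pi" "\<lambda>\<theta>. Re (trig_poly \<kappa> q \<theta>)"]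
    by (auto intro!: continuous_intros)
  have "Re (trig_poly \<kappa> q \<theta>0) \<le> Re (trig_poly \<kappa> q \<theta>)" for \<theta>
    by (rule trig_poly_torus[of \<kappa> q \<theta>]) (use \<theta>0 torus_subset_cube in force)
  with pos_cone_pos[OF assms] show thesis by (rule that)
qed

lemma openin_pos_cone: "openin (top_of_set (herm_space \<kappa>)) (pos_cone \<kappa>)"
proof (rule openin_euclidean_subtopology_iff[THEN iffD2], intro conjI ballI)
  show "pos_cone \<kappa> \<subseteq> herm_space \<kappa>" by (auto simp: pos_cone_def)
  fix q assume q: "q \<in> pos_cone \<kappa>"
  obtain m where m: "0 < m" "\<And>\<theta>. m \<le> Re (trig_poly \<kappa> q \<theta>)"
    using pos_cone_lower_bound[OF q] by blast
  show "\<exists>e>0. \<forall>r\<in>herm_space \<kappa>. dist r q < e \<longrightarrow> r \<in> pos_cone \<kappa>"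
  \<comment> \<open>A coefficient change of norm below m / n, with n the number of indices, moves
    every value of the polynomial by less than the lower bound m.\<close>
  proof (intro exI[of _ "m / CARD('n)"] conjI ballI impI)
    show "0 < m / CARD('n)" using m by simp
    fix r assume r: "r \<in> herm_space \<kappa>" "dist r q < m / CARD('n)"
    have "0 < Re (trig_poly \<kappa> r \<theta>)" for \<theta>
    proof -
      have "\<bar>Re (trig_poly \<kappa> (r - q) \<theta>)\<bar> \<le> norm (trig_poly \<kappa> (r - q) \<theta>)"
        by (rule abs_Re_le_cmod)
      also have "\<dots> \<le> CARD('n) * norm (r - q)" by (rule norm_trig_poly_le_card)
      also have "\<dots> < m" using r(2) by (simp add: dist_norm field_simps)
      finally show ?thesis using m(2)[of \<theta>] by (simp add: trig_poly_diff)
    qed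
    with r show "r \<in> pos_cone \<kappa>" by (simp add: pos_cone_def)
  qed
qed

lemma scaleR_pos_cone: "q \<in> pos_cone \<kappa> \<Longrightarrow> 0 < a \<Longrightarrow> a *\<^sub>R q \<in> pos_cone \<kappa>"
  using subspace_mul[OF subspace_herm_space, of q \<kappa> a]
  by (auto simp: pos_cone_def trig_poly_scaleR)

lemma dual_cone_inner: "c \<in> dual_cone \<kappa> \<Longrightarrow> r \<in> closure (pos_cone \<kappa>) \<Longrightarrow> r \<noteq> 0 \<Longrightarrow> 0 < c \<bullet> r"
  by (auto simp: dual_cone_def Re_coeff_pairing)

text \<open>By compactness c has a positive lower bound m on the unit vectors of the closed cone,
  and by Cauchy-Schwarz a perturbation of c smaller than m / 2 loses at most half of it. This serves
  twice: for the openness of the dual cone, and to bound q by its moments.\<close>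

lemma dual_cone_coercive:
  assumes c: "c \<in> dual_cone \<kappa>"
  obtains \<delta> where "0 < \<delta>" "\<And>c' q. dist c' c < \<delta> \<Longrightarrow> q \<in> closure (pos_cone \<kappa>) \<Longrightarrow> \<delta> * norm q \<le> c' \<bullet> q"
proof -
  let ?K = "closure (pos_cone \<kappa>) \<inter> sphere 0 1"
  have "\<exists>m>0. \<forall>u\<in>?K. m \<le> c \<bullet> u"
  proof (cases "?K = {}")
    case False
    have "compact ?K" by (simp add: closed_Int_compact)
    moreover have "continuous_on ?K (\<lambda>u. c \<bullet> u)" by (intro continuous_intros)
    ultimately obtain u where u: "u \<in> ?K" "\<forall>v\<in>?K. c \<bullet> u \<le> c \<bullet> v"
      using continuous_attains_inf[OF _ False] by blast
    have "u \<noteq> 0" using u(1) by auto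
    with u dual_cone_inner[OF c] show ?thesis by blast
  qed (auto intro: exI[of _ 1])
  then obtain m where m: "0 < m" "\<And>u. u \<in> ?K \<Longrightarrow> m \<le> c \<bullet> u" by blast
  \<comment> \<open>Normalising q uses the scaling invariance of the open cone; the closed
    inequality then passes to the closure.\<close>
  have pos: "m / 2 * norm q \<le> c' \<bullet> q" if d: "dist c' c < m / 2" and q: "q \<in> pos_cone \<kappa>" for c' q
  proof (cases "q = 0")
    case False
    have "(1 / norm q) *\<^sub>R q \<in> ?K"
      using scaleR_pos_cone[OF q, of "1 / norm q"] False closure_subset[of "pos_cone \<kappa>"] by auto
    from m(2)[OF this] False have "m * norm q \<le> c \<bullet> q" by (simp add: field_simps)
    moreover have "\<bar>(c' - c) \<bullet> q\<bar> \<le> norm (c' - c) * norm q" by (rule Cauchy_Schwarz_ineq2)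
    moreover have "norm (c' - c) * norm q \<le> m / 2 * norm q"
      using d by (intro mult_right_mono) (auto simp: dist_norm)
    ultimately show ?thesis by (simp add: inner_diff_left field_simps)
  qed simp
  show thesis
  proof (rule that)
    show "0 < m / 2" using m by simp
    fix c' q assume d: "dist c' c < m / 2" and q: "q \<in> closure (pos_cone \<kappa>)"
    have "closed {q. m / 2 * norm q \<le> c' \<bullet> q}"
      by (intro closed_Collect_le continuous_intros)
    then have "closure (pos_cone \<kappa>) \<subseteq> {q. m / 2 * norm q \<le> c' \<bullet> q}"
      by (rule closure_minimal[rotated]) (use pos[OF d] in auto)
    with q show "m / 2 * norm q \<le> c' \<bullet> q" by blast
  qed
qed

lemma openin_dual_cone: "openin (top_of_set (herm_space \<kappa>)) (dual_cone \<kappa>)"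
proof (rule openin_euclidean_subtopology_iff[THEN iffD2], intro conjI ballI)
  show "dual_cone \<kappa> \<subseteq> herm_space \<kappa>" by (auto simp: dual_cone_def)
  fix c assume "c \<in> dual_cone \<kappa>"
  then obtain \<delta> where \<delta>: "0 < \<delta>"
    "\<And>c' q. dist c' c < \<delta> \<Longrightarrow> q \<in> closure (pos_cone \<kappa>) \<Longrightarrow> \<delta> * norm q \<le> c' \<bullet> q"
    by (rule dual_cone_coercive) blast
  have "c' \<in> dual_cone \<kappa>" if "c' \<in> herm_space \<kappa>" "dist c' c < \<delta>" for c'
  proof -
    have "0 < c' \<bullet> q" if "q \<in> closure (pos_cone \<kappa>)" "q \<noteq> 0" for q
      using \<delta>(2)[OF \<open>dist c' c < \<delta>\<close> that(1)] \<delta>(1) that(2)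
      by (meson less_le_trans mult_pos_pos zero_less_norm_iff)
    with that(1) show ?thesis by (auto simp: dual_cone_def Re_coeff_pairing)
  qed
  with \<delta>(1) show "\<exists>e>0. \<forall>c'\<in>herm_space \<kappa>. dist c' c < e \<longrightarrow> c' \<in> dual_cone \<kappa>" by blast
qed

lemma convex_dual_cone: "convex (dual_cone \<kappa>)"
proof (rule convexI)
  fix c c' and u v :: real
  assume c: "c \<in> dual_cone \<kappa>" "c' \<in> dual_cone \<kappa>" and uv: "0 \<le> u" "0 \<le> v" "u + v = 1"
  have "0 < u * (c \<bullet> q) + v * (c' \<bullet> q)" if "q \<in> closure (pos_cone \<kappa>)" "q \<noteq> 0" for q
  proof (cases "u = 0")
    case True
    with uv dual_cone_inner[OF c(2) that] show ?thesis by simp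
  next
    case False
    with uv dual_cone_inner[OF c(1) that] dual_cone_inner[OF c(2) that] show ?thesis
      by (intro add_pos_nonneg) auto
  qed
  moreover have "u *\<^sub>R c + v *\<^sub>R c' \<in> herm_space \<kappa>"
    using c by (intro subspace_add subspace_mul subspace_herm_space) (auto simp: dual_cone_def)
  ultimately show "u *\<^sub>R c + v *\<^sub>R c' \<in> dual_cone \<kappa>"
    by (auto simp: dual_cone_def Re_coeff_pairing inner_add_left)
qed

end

section \<open>The moment map: values in the dual cone, injectivity\<close>

locale moment_problem = index_set \<kappa> for \<kappa> :: "'n::finite \<Rightarrow> int ^ 'd::finite" +
  fixes p :: "complex ^ 'n"
  assumes p: "p \<in> pos_cone \<kappa>"
begin

definition dm_const :: real where "dm_const = (1 / (2 * pi)) ^ CARD('d)"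

lemma dm_const_pos: "0 < dm_const" by (simp add: dm_const_def)

lemma continuous_on_quotient:
  "q \<in> pos_cone \<kappa> \<Longrightarrow> continuous_on S (\<lambda>\<theta>. trig_poly \<kappa> p \<theta> / trig_poly \<kappa> q \<theta>)"
  by (intro continuous_intros) (simp add: pos_cone_nonzero)

lemma moment_map_nth:
  assumes "q \<in> pos_cone \<kappa>"
  shows "moment_map \<kappa> p q $ i =
    dm_const *\<^sub>R integral cube (\<lambda>\<theta>. cnj (chr (\<kappa> i) \<theta>) * (trig_poly \<kappa> p \<theta> / trig_poly \<kappa> q \<theta>))"
  unfolding moment_map_def exp_eq_cnj_chr
  by (simp add: dm_const_def torus_integral_eq continuous_intros pos_cone_nonzero[OF assms])

lemma moment_map_inner:
  assumes q: "q \<in> pos_cone \<kappa>" and r: "r \<in> herm_space \<kappa>"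
  shows "moment_map \<kappa> p q \<bullet> r = dm_const * integral cube
    (\<lambda>\<theta>. Re (trig_poly \<kappa> p \<theta>) / Re (trig_poly \<kappa> q \<theta>) * Re (trig_poly \<kappa> r \<theta>))"
proof -
  let ?f = "\<lambda>\<theta>. trig_poly \<kappa> p \<theta> / trig_poly \<kappa> q \<theta>"
  have "coeff_pairing (moment_map \<kappa> p q) r =
      dm_const *\<^sub>R (\<Sum>i\<in>UNIV. integral cube (\<lambda>\<theta>. cnj (chr (\<kappa> i) \<theta>) * ?f \<theta>) * cnj (r $ i))"
    by (simp add: coeff_pairing_def moment_map_nth[OF q] scaleR_sum_right)
  also have "\<dots> = dm_const *\<^sub>R integral cube (\<lambda>\<theta>. ?f \<theta> * cnj (trig_poly \<kappa> r \<theta>))"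
    by (simp only: sum_integral_chr[OF continuous_on_quotient[OF q]])
  finally have "moment_map \<kappa> p q \<bullet> r = dm_const * Re (integral cube (\<lambda>\<theta>. ?f \<theta> * cnj (trig_poly \<kappa> r \<theta>)))"
    by (simp flip: Re_coeff_pairing)
  also have "Re (integral cube (\<lambda>\<theta>. ?f \<theta> * cnj (trig_poly \<kappa> r \<theta>))) =
      integral cube (\<lambda>\<theta>. Re (?f \<theta> * cnj (trig_poly \<kappa> r \<theta>)))"
    by (rule Re_integral) (intro integrable_continuous continuous_intros continuous_on_quotient[OF q])
  also have "(\<lambda>\<theta>. Re (?f \<theta> * cnj (trig_poly \<kappa> r \<theta>))) = (\<lambda>\<theta>. Re (complex_of_real
     (Re (trig_poly \<kappa> p \<theta>) / Re (trig_poly \<kappa> q \<theta>) * Re (trig_poly \<kappa> r \<theta>))))"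
    using p q r pos_cone_herm
    by (subst (1 2 3) of_real_Re_trig_poly[symmetric]) (auto simp del: Re_complex_of_real)
  finally show ?thesis by simp
qed

text \<open>P / Q is real, so conjugating the integral only replaces k by - k in the kernel.\<close>

lemma moment_map_herm:
  assumes q: "q \<in> pos_cone \<kappa>"
  shows "moment_map \<kappa> p q \<in> herm_space \<kappa>"
proof -
  have *: "cnj (trig_poly \<kappa> r \<theta>) = trig_poly \<kappa> r \<theta>" if "r \<in> herm_space \<kappa>" for r \<theta>
    using trig_poly_real[OF inj sym that] by (simp add: Reals_cnj_iff)
  have "chr (- k) \<theta> = cnj (chr k \<theta>)" for k and \<theta> :: "real^'d"
    by (simp add: chr_eq_cis cis_cnj freq_pairing_def sum_negf)
  then show ?thesis
    by (auto simp: herm_space_def moment_map_nth[OF q] integral_cnj *[OF pos_cone_herm[OF q]] 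
       *[OF pos_cone_herm[OF p]])
qed

lemma continuous_on_quotient_real:
  "q \<in> pos_cone \<kappa> \<Longrightarrow> continuous_on S (\<lambda>\<theta>. Re (trig_poly \<kappa> p \<theta>) / Re (trig_poly \<kappa> q \<theta>))"
  by (intro continuous_intros) (metis pos_cone_pos less_irrefl)

text \<open>An element of the closed cone is only nonnegative. If it is not the zero vector,
  independence of the characters gives a point where it does not vanish, and the continuous
  nonnegative integrand then has a positive integral.\<close>

lemma moment_map_dual_cone:
  assumes q: "q \<in> pos_cone \<kappa>"
  shows "moment_map \<kappa> p q \<in> dual_cone \<kappa>"
proof -
  have "0 < moment_map \<kappa> p q \<bullet> r" if r: "r \<in> closure (pos_cone \<kappa>)" "r \<noteq> 0" for r
  proof -
    obtain \<theta>0 where \<theta>0: "\<theta>0 \<in> torus" "trig_poly \<kappa> r \<theta>0 \<noteq> 0"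
      using trig_poly_eq_0[OF inj, of r] r by blast
    have nz: "Re (trig_poly \<kappa> r \<theta>0) \<noteq> 0"
      using \<theta>0(2) of_real_Re_trig_poly[OF closure_pos_cone(1)[OF r(1)], of \<theta>0] by force
    have "0 < integral cube
      (\<lambda>\<theta>. Re (trig_poly \<kappa> p \<theta>) / Re (trig_poly \<kappa> q \<theta>) * Re (trig_poly \<kappa> r \<theta>))"
    proof (rule integral_cube_pos)
      show "\<theta>0 \<in> cube" using \<theta>0 torus_subset_cube by blast
      show "Re (trig_poly \<kappa> p \<theta>0) / Re (trig_poly \<kappa> q \<theta>0) * Re (trig_poly \<kappa> r \<theta>0) \<noteq> 0"
        using nz pos_cone_pos[OF p, of \<theta>0] pos_cone_pos[OF q, of \<theta>0] by simp
      show "0 \<le> Re (trig_poly \<kappa> p \<theta>) / Re (trig_poly \<kappa> q \<theta>) * Re (trig_poly \<kappa> r \<theta>)" for \<theta>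
        using closure_pos_cone(2)[OF r(1)] pos_cone_pos[OF p, of \<theta>] pos_cone_pos[OF q, of \<theta>] by simp
    qed (intro continuous_intros continuous_on_quotient_real q)
    then show ?thesis
      by (simp add: moment_map_inner[OF q closure_pos_cone(1)[OF r(1)]] dm_const_pos)
  qed
  with moment_map_herm[OF q] show ?thesis by (auto simp: dual_cone_def Re_coeff_pairing)
qed

lemma inj_on_moment_map: "inj_on (moment_map \<kappa> p) (pos_cone \<kappa>)"
proof (rule inj_onI, rule ccontr)
  fix q q' assume q: "q \<in> pos_cone \<kappa>" "q' \<in> pos_cone \<kappa>"
    and eq: "moment_map \<kappa> p q = moment_map \<kappa> p q'" and ne: "q \<noteq> q'"
  let ?r = "q' - q"
  let ?P = "\<lambda>\<theta>. Re (trig_poly \<kappa> p \<theta>)" and ?Q = "\<lambda>\<theta>. Re (trig_poly \<kappa> q \<theta>)"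
    and ?Q' = "\<lambda>\<theta>. Re (trig_poly \<kappa> q' \<theta>)" and ?R = "\<lambda>\<theta>. Re (trig_poly \<kappa> ?r \<theta>)"
  have r: "?r \<in> herm_space \<kappa>"
    using q by (intro subspace_diff subspace_herm_space pos_cone_herm)
  obtain \<theta>0 where \<theta>0: "\<theta>0 \<in> torus" "trig_poly \<kappa> ?r \<theta>0 \<noteq> 0"
    using trig_poly_eq_0[OF inj, of ?r] ne by force
  have nz: "?R \<theta>0 \<noteq> 0"
    using \<theta>0(2) of_real_Re_trig_poly[OF r, of \<theta>0] by force
  have pos: "?P \<theta> > 0" "?Q \<theta> > 0" "?Q' \<theta> > 0" for \<theta>
    using pos_cone_pos p q by auto
  \<comment> \<open>Because ?R is Q' - Q, the difference 1 / Q - 1 / Q' equals ?R / (Q Q').\<close>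
  have key: "?P \<theta> / ?Q \<theta> * ?R \<theta> - ?P \<theta> / ?Q' \<theta> * ?R \<theta> = ?P \<theta> * (?R \<theta>)\<^sup>2 / (?Q \<theta> * ?Q' \<theta>)" for \<theta>
    using pos[of \<theta>] by (simp add: trig_poly_diff field_simps power2_eq_square)
  have "integral cube (\<lambda>\<theta>. ?P \<theta> / ?Q \<theta> * ?R \<theta>) = integral cube (\<lambda>\<theta>. ?P \<theta> / ?Q' \<theta> * ?R \<theta>)"
    using moment_map_inner[OF q(1) r] moment_map_inner[OF q(2) r] eq dm_const_pos by simp
  moreover have "integral cube (\<lambda>\<theta>. ?P \<theta> / ?Q \<theta> * ?R \<theta> - ?P \<theta> / ?Q' \<theta> * ?R \<theta>) =
    integral cube (\<lambda>\<theta>. ?P \<theta> / ?Q \<theta> * ?R \<theta>) - integral cube (\<lambda>\<theta>. ?P \<theta> / ?Q' \<theta> * ?R \<theta>)"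
    by (intro integral_diff integrable_continuous continuous_intros continuous_on_quotient_real q)
  ultimately have "integral cube (\<lambda>\<theta>. ?P \<theta> * (?R \<theta>)\<^sup>2 / (?Q \<theta> * ?Q' \<theta>)) = 0"
    by (simp only: key)
  moreover have "0 < integral cube (\<lambda>\<theta>. ?P \<theta> * (?R \<theta>)\<^sup>2 / (?Q \<theta> * ?Q' \<theta>))"
  proof (rule integral_cube_pos)
    show "continuous_on cube (\<lambda>\<theta>. ?P \<theta> * (?R \<theta>)\<^sup>2 / (?Q \<theta> * ?Q' \<theta>))"
      by (intro continuous_intros) (simp add: pos less_imp_neq[symmetric])
    show "\<theta>0 \<in> cube" using \<theta>0 torus_subset_cube by blast
    show "?P \<theta>0 * (?R \<theta>0)\<^sup>2 / (?Q \<theta>0 * ?Q' \<theta>0) \<noteq> 0"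
      using nz pos[of \<theta>0] by simp
    show "0 \<le> ?P \<theta> * (?R \<theta>)\<^sup>2 / (?Q \<theta> * ?Q' \<theta>)" for \<theta>
      using pos[of \<theta>] by simp
  qed
  ultimately show False by simp
qed

end

section \<open>Properness\<close>

lemma one_minus_cos_le: "2 * (1 - cos x) \<le> x\<^sup>2" for x :: real
proof -
  have "\<bar>sin (x / 2)\<bar> \<le> \<bar>x / 2\<bar>" by (rule abs_sin_x_le_abs_x)
  then have "(sin (x / 2))\<^sup>2 \<le> (x / 2)\<^sup>2" by (simp only: abs_le_square_iff)
  moreover have "cos x = 1 - 2 * (sin (x / 2))\<^sup>2"
    using cos_double_sin[of "x / 2"] by simp
  ultimately show ?thesis by (simp add: power_divide)
qed

text \<open>Adding the nonnegative value at \<open>\<theta> - h\<close> cancels the first-order term, so no Taylor expansion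
  at a minimum is needed.\<close>

lemma trig_poly_growth:
  assumes "0 \<le> Re (trig_poly \<kappa> q (\<theta> - h))"
  shows "Re (trig_poly \<kappa> q (\<theta> + h)) \<le>
    2 * Re (trig_poly \<kappa> q \<theta>) + (\<Sum>i\<in>UNIV. norm (q $ i) * (freq_pairing (\<kappa> i) h)\<^sup>2)"
proof -
  \<comment> \<open>A symmetric second difference acts on a character as multiplication by the real
    number - 2 (1 - cos (k, h)), which is quadratic in h.\<close>
  have *: "chr k (\<theta> + h) + chr k (\<theta> - h) - 2 * chr k \<theta> =
      - complex_of_real (2 * (1 - cos (freq_pairing k h))) * chr k \<theta>" for k
    by (simp add: chr_eq_cis freq_pairing_add freq_pairing_diff complex_eq_iff
        cos_add cos_diff sin_add sin_diff algebra_simps)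
  have "trig_poly \<kappa> q (\<theta> + h) + trig_poly \<kappa> q (\<theta> - h) - 2 * trig_poly \<kappa> q \<theta> =
      (\<Sum>i\<in>UNIV. q $ i * (chr (\<kappa> i) (\<theta> + h) + chr (\<kappa> i) (\<theta> - h) - 2 * chr (\<kappa> i) \<theta>))"
    by (simp add: trig_poly_chr algebra_simps sum.distrib sum_subtractf sum_distrib_left)
  then have "Re (trig_poly \<kappa> q (\<theta> + h)) + Re (trig_poly \<kappa> q (\<theta> - h)) - 2 * Re (trig_poly \<kappa> q \<theta>)
    = Re (\<Sum>i\<in>UNIV. q $ i * (- complex_of_real (2 * (1 - cos (freq_pairing (\<kappa> i) h))) * chr (\<kappa> i) \<theta>))"
    unfolding * by (simp add: complex_eq_iff)
  also have "\<dots> \<le> norm (\<Sum>i\<in>UNIV. q $ i * (- complex_of_real (2 * (1 - cos (freq_pairing (\<kappa> i) h))) * chr (\<kappa> i) \<theta>))"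
    by (rule complex_Re_le_cmod)
  also have "\<dots> \<le> (\<Sum>i\<in>UNIV. norm (q $ i) * (freq_pairing (\<kappa> i) h)\<^sup>2)"
  proof (rule order_trans[OF norm_sum], rule sum_mono)
    fix i
    have "norm (- complex_of_real (2 * (1 - cos (freq_pairing (\<kappa> i) h))) * chr (\<kappa> i) \<theta>) =
        2 * (1 - cos (freq_pairing (\<kappa> i) h))"
      by (simp only: norm_mult norm_minus_cancel norm_of_real norm_chr) simp
    also have "\<dots> \<le> (freq_pairing (\<kappa> i) h)\<^sup>2" by (rule one_minus_cos_le)
    finally show "norm (q $ i * (- complex_of_real (2 * (1 - cos (freq_pairing (\<kappa> i) h))) * chr (\<kappa> i) \<theta>))
      \<le> norm (q $ i) * (freq_pairing (\<kappa> i) h)\<^sup>2"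
      by (subst norm_mult) (rule mult_left_mono, auto)
  qed
  finally show ?thesis using assms by linarith
qed

lemma freq_pairing_bound:
  fixes \<kappa> :: "'n::finite \<Rightarrow> int ^ 'd::finite"
  obtains L where "0 \<le> L" "\<And>i h s. (\<And>j. \<bar>h $ j\<bar> \<le> s) \<Longrightarrow> \<bar>freq_pairing (\<kappa> i) h\<bar> \<le> L * s"
proof -
  define L :: real where "L = (\<Sum>i\<in>UNIV. \<Sum>j\<in>UNIV. \<bar>of_int (\<kappa> i $ j)\<bar>)"
  have "\<bar>freq_pairing (\<kappa> i) h\<bar> \<le> L * s" if h: "\<And>j. \<bar>h $ j\<bar> \<le> s" for i h s
  proof -
    have s: "0 \<le> s" using h[of undefined] by linarith
    have "\<bar>freq_pairing (\<kappa> i) h\<bar> \<le> (\<Sum>j\<in>UNIV. \<bar>of_int (\<kappa> i $ j)\<bar> * s)"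
      unfolding freq_pairing_def
      by (rule order_trans[OF sum_abs]) (auto simp: abs_mult intro!: sum_mono mult_left_mono h)
    also have "\<dots> = (\<Sum>j\<in>UNIV. \<bar>of_int (\<kappa> i $ j)\<bar>) * s"
      by (rule sum_distrib_right[symmetric])
    also have "(\<Sum>j\<in>UNIV. \<bar>of_int (\<kappa> i $ j)\<bar>) \<le> L"
      unfolding L_def by (rule member_le_sum) (auto intro: sum_nonneg)
    finally show ?thesis using s by (simp add: mult_right_mono)
  qed
  moreover have "0 \<le> L" unfolding L_def by (intro sum_nonneg) auto
  ultimately show thesis using that by blast
qed

text \<open>The terms that survive form a geometric sum, dominated by its last one, which is at most
  1 / x; the true factor 4 / 3 is rounded up to 2. With x = g \<theta> this bounds 1 / g from below
  by counting the dyadic levels under which g lies.\<close>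

lemma dyadic_sum_le:
  fixes x :: real
  assumes "0 < x"
  shows "(\<Sum>j\<le>J. if x \<le> 1 / 4 ^ j then 4 ^ j else 0) \<le> 2 / x"
proof (induction J)
  case (Suc J)
  show ?case
  proof (cases "x \<le> 1 / 4 ^ Suc J")
    case True
    have geo: "(\<Sum>j\<le>N. (4::real) ^ j) \<le> 2 * 4 ^ N" for N
    proof (induction N)
      case (Suc N)
      then show ?case by simp (rule order_trans, assumption, simp)
    qed simp
    have "(\<Sum>j\<le>Suc J. if x \<le> 1 / 4 ^ j then 4 ^ j else 0) \<le> (\<Sum>j\<le>Suc J. (4::real) ^ j)"
      by (rule sum_mono) auto
    also have "\<dots> \<le> 2 * 4 ^ Suc J" by (rule geo)
    also have "\<dots> \<le> 2 / x" using True assms by (simp add: field_simps)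
    finally show ?thesis .
  qed (use Suc in simp)
next
  case 0
  have "(\<Sum>j\<le>0. if x \<le> 1 / 4 ^ j then 4 ^ j else 0) = (if x \<le> 1 then 1 else 0 :: real)"
    by (simp only: atMost_0 sum.insert sum.empty finite.emptyI) simp
  also have "\<dots> \<le> 2 / x" using assms by (simp add: field_simps)
  finally show ?case .
qed

text \<open>The point may lie on the boundary of \<open>cube\<close>, so it is made a corner and
  each side is directed inwards according to the sign of the coordinate. Since s is at most pi, the
  full volume then fits.\<close>

lemma corner_cube:
  fixes \<theta>0 :: "real ^ 'd::finite"
  assumes "\<theta>0 \<in> cube" "0 < s" "s \<le> pi"
  obtains a b where "cbox a b \<subseteq> cube" "measure lborel (cbox a b) = s ^ CARD('d)"
    "\<And>\<theta> j. \<theta> \<in> cbox a b \<Longrightarrow> \<bar>(\<theta> - \<theta>0) $ j\<bar> \<le> s"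
proof -
  define a where "a = (\<chi> j. if \<theta>0 $ j \<le> 0 then \<theta>0 $ j else \<theta>0 $ j - s)"
  have a: "\<theta>0 $ j - s \<le> a $ j" "a $ j \<le> \<theta>0 $ j" "- pi \<le> a $ j" "a $ j + s \<le> pi" for j
    using assms by (auto simp: a_def mem_box_cart)
  show thesis
  proof (rule that[of a "\<chi> j. a $ j + s"])
    show "cbox a (\<chi> j. a $ j + s) \<subseteq> cube"
      using a by (auto simp: mem_box_cart) (smt (verit))+
    have "cbox a (\<chi> j. a $ j + s) \<noteq> {}"
      using assms by (auto simp: interval_ne_empty_cart)
    then show "measure lborel (cbox a (\<chi> j. a $ j + s)) = s ^ CARD('d)"
      by (simp add: content_cbox_cart)
    show "\<bar>(\<theta> - \<theta>0) $ j\<bar> \<le> s" if "\<theta> \<in> cbox a (\<chi> j. a $ j + s)" for \<theta> j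
      using that a[of j] by (auto simp: mem_box_cart abs_le_iff) (smt (verit))+
  qed
qed

text \<open>On the cube of side \<open>a / 2 ^ j\<close> at \<open>\<theta>0\<close> the integrand is at least \<open>4 ^ j\<close>. In dimension at most 2
  the volume of this cube is at least of order \<open>1 / 4 ^ j\<close>, so that every scale contributes a fixed amount.\<close>

lemma integral_inverse_ge:
  fixes g :: "real ^ 'd::finite \<Rightarrow> real"
  assumes d: "CARD('d) \<le> 2"
    and g: "continuous_on cube g" "\<And>\<theta>. 0 < g \<theta>"
    and \<theta>0: "\<theta>0 \<in> cube" "g \<theta>0 \<le> 1 / 4 ^ J / 4"
    and growth: "\<And>h s. (\<And>j. \<bar>h $ j\<bar> \<le> s) \<Longrightarrow> g (\<theta>0 + h) \<le> 2 * g \<theta>0 + C * s\<^sup>2"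
    and a: "0 < a" "a \<le> pi" "C * a\<^sup>2 \<le> 1 / 2"
  shows "a ^ CARD('d) * real (Suc J) / 2 \<le> integral cube (\<lambda>\<theta>. 1 / g \<theta>)"
proof -
  have "\<exists>B. (\<exists>u v. B = cbox u v) \<and> B \<subseteq> cube \<and> measure lborel B = (a / 2 ^ j) ^ CARD('d) \<and>
      (\<forall>\<theta>\<in>B. \<forall>i. \<bar>(\<theta> - \<theta>0) $ i\<bar> \<le> a / 2 ^ j)" for j :: nat
  proof -
    have "a / 2 ^ j \<le> a" using a by (simp add: divide_le_eq)
    then obtain u v where "cbox u v \<subseteq> cube" "measure lborel (cbox u v) = (a / 2 ^ j) ^ CARD('d)"
      "\<And>\<theta> i. \<theta> \<in> cbox u v \<Longrightarrow> \<bar>(\<theta> - \<theta>0) $ i\<bar> \<le> a / 2 ^ j"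
      using corner_cube[OF \<theta>0(1), of "a / 2 ^ j"] a by auto
    then show ?thesis by blast
  qed
  then obtain B :: "nat \<Rightarrow> (real^'d) set" where B: "\<And>j. \<exists>u v. B j = cbox u v" "\<And>j. B j \<subseteq> cube"
    "\<And>j. measure lborel (B j) = (a / 2 ^ j) ^ CARD('d)"
    "\<And>j \<theta> i. \<theta> \<in> B j \<Longrightarrow> \<bar>(\<theta> - \<theta>0) $ i\<bar> \<le> a / 2 ^ j"
    by metis
  \<comment> \<open>Each of the two terms of the growth bound gets half of 1 / 4 ^ j: the value at
    \<theta>0 because it is at most a quarter of 1 / 4 ^ J with j at most J, the quadratic term by
    the choice of a.\<close>
  have small: "g \<theta> \<le> 1 / 4 ^ j" if "\<theta> \<in> B j" "j \<le> J" for \<theta> j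
  proof -
    have "g \<theta> \<le> 2 * g \<theta>0 + C * (a / 2 ^ j)\<^sup>2"
      using growth[of "\<theta> - \<theta>0" "a / 2 ^ j"] B(4)[OF that(1)] by simp
    moreover have "C * (a / 2 ^ j)\<^sup>2 = C * a\<^sup>2 / 4 ^ j"
      by (simp add: power_divide power_mult[symmetric] mult.commute[of j]) (simp add: power_mult)
    moreover have "C * a\<^sup>2 / 4 ^ j \<le> 1 / 2 / 4 ^ j"
      using a(3) by (intro divide_right_mono) auto
    moreover have "1 / 4 ^ J \<le> 1 / (4::real) ^ j"
      using that(2) by (simp add: field_simps power_increasing)
    ultimately show ?thesis using \<theta>0(2) by simp
  qed
  have ind: "(indicator (B j) has_integral (a / 2 ^ j) ^ CARD('d)) cube" for j
  proof -
    obtain u v where uv: "B j = cbox u v" using B(1) by blast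
    have "((\<lambda>x. 1 :: real) has_integral measure lborel (B j)) (B j)"
      using has_integral_const[of "1::real" u v] by (simp add: uv)
    then have "((\<lambda>x. if x \<in> B j then 1 else 0 :: real) has_integral measure lborel (B j)) cube"
      by (simp add: has_integral_restrict[OF B(2)])
    then show ?thesis by (simp add: B(3) indicator_def [abs_def] of_bool_def)
  qed
  have "((\<lambda>\<theta>. \<Sum>j\<le>J. 4 ^ j * indicat_real (B j) \<theta>) has_integral
      (\<Sum>j\<le>J. 4 ^ j * (a / 2 ^ j) ^ CARD('d))) cube"
    by (intro has_integral_sum has_integral_mult_right ind) auto
  moreover have "((\<lambda>\<theta>. 2 * (1 / g \<theta>)) has_integral 2 * integral cube (\<lambda>\<theta>. 1 / g \<theta>)) cube"
    by (intro has_integral_mult_right integrable_integral integrable_continuous continuous_intros g)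
      (metis g(2) less_irrefl)
  moreover have "(\<Sum>j\<le>J. 4 ^ j * indicat_real (B j) \<theta>) \<le> 2 * (1 / g \<theta>)" for \<theta>
  proof -
    have "(\<Sum>j\<le>J. 4 ^ j * indicat_real (B j) \<theta>) \<le> (\<Sum>j\<le>J. if g \<theta> \<le> 1 / 4 ^ j then 4 ^ j else 0)"
      by (rule sum_mono) (auto simp: indicator_def small)
    also have "\<dots> \<le> 2 / g \<theta>" by (rule dyadic_sum_le) (rule g(2))
    finally show ?thesis by simp
  qed
  ultimately have "(\<Sum>j\<le>J. 4 ^ j * (a / 2 ^ j) ^ CARD('d)) \<le> 2 * integral cube (\<lambda>\<theta>. 1 / g \<theta>)"
    by (rule has_integral_le)
  moreover have "(\<Sum>j\<le>J. a ^ CARD('d)) \<le> (\<Sum>j\<le>J. 4 ^ j * (a / 2 ^ j) ^ CARD('d))"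
  proof (rule sum_mono)
    fix j :: nat
    \<comment> \<open>The bound on the dimension is spent here.\<close>
    have "((2::real) ^ j) ^ CARD('d) \<le> (2 ^ j) ^ 2" by (rule power_increasing[OF d]) simp
    also have "\<dots> = 4 ^ j" by (simp add: power_mult[symmetric] mult.commute[of j]) (simp add: power_mult)
    finally have "a ^ CARD('d) * ((2::real) ^ j) ^ CARD('d) \<le> a ^ CARD('d) * 4 ^ j"
      using a(1) by (intro mult_left_mono) auto
    then show "a ^ CARD('d) \<le> 4 ^ j * (a / 2 ^ j) ^ CARD('d)"
      by (simp add: power_divide field_simps)
  qed
  ultimately show ?thesis by (simp add: algebra_simps)
qed

section \<open>A uniform lower bound on Q from bounded moments\<close>

context moment_problem
begin

text \<open>This is why 0 must belong to \<Lambda>: the constant character makes the integral of P /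
  Q itself a moment, so a bound on the moments controls it.\<close>

lemma moment_map_zero_index:
  assumes q: "q \<in> pos_cone \<kappa>" and "\<kappa> i = 0"
  shows "Re (moment_map \<kappa> p q $ i) =
    dm_const * integral cube (\<lambda>\<theta>. Re (trig_poly \<kappa> p \<theta>) / Re (trig_poly \<kappa> q \<theta>))"
proof -
  have "Re (moment_map \<kappa> p q $ i) = dm_const * Re (integral cube (\<lambda>\<theta>. trig_poly \<kappa> p \<theta> / trig_poly \<kappa> q \<theta>))"
    by (simp add: moment_map_nth[OF q] assms(2))
  also have "Re (integral cube (\<lambda>\<theta>. trig_poly \<kappa> p \<theta> / trig_poly \<kappa> q \<theta>)) =
      integral cube (\<lambda>\<theta>. Re (trig_poly \<kappa> p \<theta> / trig_poly \<kappa> q \<theta>))"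
    by (intro Re_integral integrable_continuous continuous_on_quotient q)
  also have "(\<lambda>\<theta>. Re (trig_poly \<kappa> p \<theta> / trig_poly \<kappa> q \<theta>)) =
      (\<lambda>\<theta>. Re (complex_of_real (Re (trig_poly \<kappa> p \<theta>) / Re (trig_poly \<kappa> q \<theta>))))"
    by (simp only: of_real_divide of_real_Re_trig_poly pos_cone_herm p q)
  finally show ?thesis by simp
qed

lemma moment_map_proper:
  assumes d: "CARD('d) \<le> 2" and i: "\<kappa> i = 0"
  obtains \<epsilon> where "0 < \<epsilon>" "\<And>q \<theta>. \<lbrakk>q \<in> pos_cone \<kappa>; norm q \<le> R; Re (moment_map \<kappa> p q $ i) \<le> M\<rbrakk> \<Longrightarrow>
    \<epsilon> \<le> Re (trig_poly \<kappa> q \<theta>)"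
proof -
  obtain m where m: "0 < m" "\<And>\<theta>. m \<le> Re (trig_poly \<kappa> p \<theta>)"
    using pos_cone_lower_bound[OF p] by blast
  obtain L where L: "0 \<le> L" "\<And>i h s. (\<And>j. \<bar>h $ j\<bar> \<le> s) \<Longrightarrow> \<bar>freq_pairing (\<kappa> i) h\<bar> \<le> L * s"
    by (rule freq_pairing_bound[of \<kappa>]) blast
  \<comment> \<open>The growth bound is a sum over all indices of terms at most \<bar>R\<bar> L^2
    s^2. Adding 1 gives 1 \<le> C, so that a = 1 / (2 C) stays below pi and C a^2 = 1 / (4 C) is at
    most 1 / 2.\<close>
  define C where "C = CARD('n) * (\<bar>R\<bar> * L\<^sup>2) + 1"
  define a where "a = 1 / (2 * C)"
  have C: "1 \<le> C" unfolding C_def by simp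
  have "a \<le> 1" "0 < a" using C by (auto simp: a_def field_simps)
  with pi_gt3 have a: "0 < a" "a \<le> pi" by linarith+
  have Ca: "C * a\<^sup>2 \<le> 1 / 2"
    using C by (simp add: a_def power2_eq_square field_simps)
  have "0 < dm_const * m * a ^ CARD('d) / 2" using dm_const_pos m a by simp
  \<comment> \<open>J is chosen so that J + 1 dyadic scales, each worth the positive amount in
    parentheses, exceed the moment bound M.\<close>
  then obtain J :: nat where "M < J * (dm_const * m * a ^ CARD('d) / 2)"
    using reals_Archimedean3 by blast
  with \<open>0 < dm_const * m * a ^ CARD('d) / 2\<close> have J: "M < Suc J * (dm_const * m * a ^ CARD('d) / 2)"
    by (simp add: algebra_simps)
  show thesis
  proof (rule that[of "1 / 4 ^ J / 4"])
    fix q \<theta> assume q: "q \<in> pos_cone \<kappa>" "norm q \<le> R" "Re (moment_map \<kappa> p q $ i) \<le> M"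
    let ?Q = "\<lambda>\<theta>. Re (trig_poly \<kappa> q \<theta>)"
    have Q: "0 < ?Q \<theta>" for \<theta> by (rule pos_cone_pos[OF q(1)])
    show "1 / 4 ^ J / 4 \<le> ?Q \<theta>"
    proof (rule ccontr)
      assume "\<not> ?thesis"
      \<comment> \<open>Any point with a small value will do as centre, minimal or not; it only has
        to be moved into the cube of integration.\<close>
      moreover obtain \<theta>0 where \<theta>0: "\<theta>0 \<in> torus" "trig_poly \<kappa> q \<theta>0 = trig_poly \<kappa> q \<theta>"
        by (rule trig_poly_torus)
      ultimately have small: "?Q \<theta>0 \<le> 1 / 4 ^ J / 4" by simp
      have growth: "?Q (\<theta>0 + h) \<le> 2 * ?Q \<theta>0 + C * s\<^sup>2" if h: "\<And>j. \<bar>h $ j\<bar> \<le> s" for h s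
      proof -
        have "norm (q $ k) * (freq_pairing (\<kappa> k) h)\<^sup>2 \<le> \<bar>R\<bar> * (L\<^sup>2 * s\<^sup>2)" for k
        proof (rule mult_mono)
          show "norm (q $ k) \<le> \<bar>R\<bar>"
            using Finite_Cartesian_Product.norm_nth_le[of q k] q(2) by linarith
          have "\<bar>freq_pairing (\<kappa> k) h\<bar>\<^sup>2 \<le> (L * s)\<^sup>2"
            using L(2)[OF h] by (intro power_mono) auto
          then show "(freq_pairing (\<kappa> k) h)\<^sup>2 \<le> L\<^sup>2 * s\<^sup>2" by (simp add: power_mult_distrib)
        qed auto
        then have "(\<Sum>k\<in>UNIV. norm (q $ k) * (freq_pairing (\<kappa> k) h)\<^sup>2) \<le> (\<Sum>k\<in>(UNIV::'n set). \<bar>R\<bar> * (L\<^sup>2 * s\<^sup>2))"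
          by (intro sum_mono)
        also have "\<dots> \<le> C * s\<^sup>2" by (simp add: C_def algebra_simps)
        finally show ?thesis
          using trig_poly_growth[of \<kappa> q \<theta>0 h] Q[of "\<theta>0 - h"] by linarith
      qed
      have "a ^ CARD('d) * real (Suc J) / 2 \<le> integral cube (\<lambda>\<theta>. 1 / ?Q \<theta>)"
        by (rule integral_inverse_ge[OF d _ Q _ small growth a Ca])
          (use \<theta>0 torus_subset_cube in \<open>auto intro!: continuous_intros\<close>)
      then have "m * (a ^ CARD('d) * real (Suc J) / 2) \<le> m * integral cube (\<lambda>\<theta>. 1 / ?Q \<theta>)"
        using m by (intro mult_left_mono) auto
      also have "\<dots> = integral cube (\<lambda>\<theta>. m * (1 / ?Q \<theta>))"
        by (rule integral_mult_right[symmetric])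
      also have "\<dots> \<le> integral cube (\<lambda>\<theta>. Re (trig_poly \<kappa> p \<theta>) / ?Q \<theta>)"
      proof (intro integral_le integrable_continuous continuous_on_quotient_real q)
        show "continuous_on cube (\<lambda>\<theta>. m * (1 / ?Q \<theta>))"
          by (intro continuous_intros) (metis Q less_irrefl)
        show "m * (1 / ?Q \<theta>) \<le> Re (trig_poly \<kappa> p \<theta>) / ?Q \<theta>" for \<theta>
          using m(2)[of \<theta>] Q[of \<theta>] by (simp add: divide_right_mono)
      qed
      finally have "dm_const * (m * (a ^ CARD('d) * real (Suc J) / 2)) \<le> Re (moment_map \<kappa> p q $ i)"
        using dm_const_pos by (simp add: moment_map_zero_index[OF q(1) i])
      with J q(3) show False by (simp add: algebra_simps)
    qed
  qed simp
qed

end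

section \<open>Smooth functions on the cone\<close>

text \<open>S is an invariant: each member is differentiable with all its directional derivatives
  again in S, so the recursion of \<open>Ck_on\<close> can be unfolded to any order. Directions
  range over the whole space, which covers every V.\<close>

lemma smooth_on_coinduct:
  assumes "f \<in> S"
    and "\<And>f. f \<in> S \<Longrightarrow> \<exists>f'. (\<forall>x\<in>U. (f has_derivative f' x) (at x within U)) \<and> (\<forall>v. (\<lambda>x. f' x v) \<in> S)"
  shows "smooth_on V U f"
  unfolding smooth_on_def
proof
  fix n
  show "Ck_on V n U f"
    using assms(1)
  proof (induction n arbitrary: f)
    case 0
    then show ?case
      using assms(2) has_derivative_continuous_on by (metis Ck_on.simps(1))
  next
    case (Suc n)
    with assms(2)[of f] show ?case by (metis Ck_on.simps(2))
  qed
qed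

text \<open>Applying g' to the remainder of f at g y gives, up to sign, the remainder of g at y.
  This suits a W with empty interior in the ambient space, such as the dual cone.\<close>

lemma has_derivative_inverse_within:
  fixes f :: "'a::real_normed_vector \<Rightarrow> 'b::real_normed_vector"
  assumes f: "(f has_derivative f') (at (g y) within U)"
    and g': "bounded_linear g'" "\<And>v. g' (f' v) = v"
    and g: "continuous_on W g" "g ` W \<subseteq> U" "\<And>z. z \<in> W \<Longrightarrow> f (g z) = z"
    and y: "y \<in> W"
  shows "(g has_derivative g') (at y within W)"
  unfolding has_derivative_within_alt2
proof (intro conjI allI impI)
  interpret g': bounded_linear g' by fact
  interpret f': bounded_linear f' by (rule has_derivative_bounded_linear[OF f])
  obtain C where C: "0 < C" "\<And>v. norm (g' v) \<le> norm v * C" using g'.pos_bounded by blast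
  fix e :: real assume "0 < e"
  \<comment> \<open>The first bound lets the remainder be absorbed, giving norm (g z - g y) \<le> 2
    C norm (z - y); the second turns the resulting factor d C * 2 C into at most e.\<close>
  define d where "d = min (1 / (2 * C)) (e / (2 * C * C))"
  have d: "0 < d" "d * C \<le> 1 / 2" "d * C * (2 * C) \<le> e"
    using C(1) \<open>0 < e\<close> by (auto simp: d_def field_simps min_def)
  have "\<forall>\<^sub>F u in at (g y) within U. norm (f u - f (g y) - f' (u - g y)) \<le> d * norm (u - g y)"
    using f d(1) unfolding has_derivative_within_alt2 by blast
  then have "\<forall>\<^sub>F u in nhds (g y). u \<noteq> g y \<longrightarrow> u \<in> U \<longrightarrow>
      norm (f u - f (g y) - f' (u - g y)) \<le> d * norm (u - g y)"
    by (simp add: eventually_at_filter)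
  moreover have "filterlim g (nhds (g y)) (at y within W)"
    using g(1) y by (simp add: continuous_on_def)
  ultimately have "\<forall>\<^sub>F z in at y within W. g z \<noteq> g y \<longrightarrow> g z \<in> U \<longrightarrow>
      norm (f (g z) - f (g y) - f' (g z - g y)) \<le> d * norm (g z - g y)"
    by (rule eventually_compose_filterlim)
  moreover have "\<forall>\<^sub>F z in at y within W. z \<in> W"
    by (simp add: eventually_at_filter)
  ultimately show "\<forall>\<^sub>F z in at y within W. norm (g z - g y - g' (z - y)) \<le> e * norm (z - y)"
  proof eventually_elim
    case (elim z)
    \<comment> \<open>The eventual estimate excludes g z = g y, a case that forces z = y because f
      undoes g on W.\<close>
    have b: "norm (z - y - f' (g z - g y)) \<le> d * norm (g z - g y)"
    proof (cases "g z = g y")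
      case True
      then have "z = y" using g(3) y elim(2) by metis
      with True show ?thesis
        by (simp add: f'.zero)
    next
      case False
      with elim g(2,3) y show ?thesis by auto
    qed
    have "norm (g z - g y - g' (z - y)) = norm (g' (z - y - f' (g z - g y)))"
      by (simp add: g'.diff g'(2) norm_minus_commute)
    also have "\<dots> \<le> norm (z - y - f' (g z - g y)) * C" by (rule C(2))
    also have "\<dots> \<le> d * norm (g z - g y) * C" using b C(1) by (intro mult_right_mono) auto
    finally have 1: "norm (g z - g y - g' (z - y)) \<le> d * C * norm (g z - g y)"
      by (simp add: mult_ac)
    have "norm (g z - g y) \<le> norm (g' (z - y)) + norm (g z - g y - g' (z - y))"
      by (rule norm_triangle_sub)
    also have "\<dots> \<le> norm (z - y) * C + 1 / 2 * norm (g z - g y)"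
      using C(2)[of "z - y"] 1 mult_right_mono[OF d(2) norm_ge_zero, of "g z - g y"] by linarith
    finally have "norm (g z - g y) \<le> 2 * C * norm (z - y)" by (simp add: mult_ac)
    then have "d * C * norm (g z - g y) \<le> d * C * (2 * C * norm (z - y))"
      using C(1) d(1) by (intro mult_left_mono) auto
    also have "\<dots> = d * C * (2 * C) * norm (z - y)" by simp
    also have "\<dots> \<le> e * norm (z - y)" using d(3) by (rule mult_right_mono) simp
    finally show ?case using 1 by linarith
  qed
qed fact

lemma has_derivative_vec_componentwise:
  fixes f :: "'a::real_normed_vector \<Rightarrow> complex ^ 'n::finite"
  assumes "\<And>i. ((\<lambda>x. f x $ i) has_derivative (\<lambda>v. f' v $ i)) F"
  shows "(f has_derivative f') F"
proof -
  have ax: "bounded_linear (axis i :: complex \<Rightarrow> complex ^ 'n)" for i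
    unfolding linear_conv_bounded_linear[symmetric]
    by (rule linearI) (simp_all add: axis_def vec_eq_iff)
  have ex: "x = (\<Sum>i\<in>UNIV. axis i (x $ i))" for x :: "complex ^ 'n"
    by (simp add: vec_eq_iff axis_def if_distrib cong: if_cong)
  have "((\<lambda>x. \<Sum>i\<in>UNIV. axis i (f x $ i)) has_derivative (\<lambda>v. \<Sum>i\<in>UNIV. axis i (f' v $ i))) F"
    by (intro has_derivative_sum bounded_linear.has_derivative[OF ax] assms)
  then show ?thesis by (simp flip: ex)
qed

text \<open>An algebra of functions on the cone that contains the moment map and its inverse Jacobian and is
  closed under partial derivatives; membership therefore implies smoothness.\<close>

inductive_set cone_algebra :: "('n::finite \<Rightarrow> int ^ 'd::finite) \<Rightarrow> (complex ^ 'n \<Rightarrow> complex) set"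
  for \<kappa> :: "'n \<Rightarrow> int ^ 'd" where
  const: "(\<lambda>_. c) \<in> cone_algebra \<kappa>"
| coord: "(\<lambda>q. q $ i) \<in> cone_algebra \<kappa>"
| int: "continuous_on UNIV \<phi> \<Longrightarrow>
    (\<lambda>q. integral cube (\<lambda>\<theta>. \<phi> \<theta> / trig_poly \<kappa> q \<theta> ^ n)) \<in> cone_algebra \<kappa>"
| add: "f \<in> cone_algebra \<kappa> \<Longrightarrow> g \<in> cone_algebra \<kappa> \<Longrightarrow> (\<lambda>q. f q + g q) \<in> cone_algebra \<kappa>"
| mult: "f \<in> cone_algebra \<kappa> \<Longrightarrow> g \<in> cone_algebra \<kappa> \<Longrightarrow> (\<lambda>q. f q * g q) \<in> cone_algebra \<kappa>"
| inverse: "f \<in> cone_algebra \<kappa> \<Longrightarrow> (\<And>q. q \<in> pos_cone \<kappa> \<Longrightarrow> f q \<noteq> 0) \<Longrightarrow>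
    (\<lambda>q. inverse (f q)) \<in> cone_algebra \<kappa>"

lemma cone_algebra_sum:
  "(\<And>i. i \<in> I \<Longrightarrow> f i \<in> cone_algebra \<kappa>) \<Longrightarrow> (\<lambda>q. \<Sum>i\<in>I. f i q) \<in> cone_algebra \<kappa>"
  by (induction I rule: infinite_finite_induct) (auto intro: cone_algebra.intros)

lemma cone_algebra_prod:
  "(\<And>i. i \<in> I \<Longrightarrow> f i \<in> cone_algebra \<kappa>) \<Longrightarrow> (\<lambda>q. \<Prod>i\<in>I. f i q) \<in> cone_algebra \<kappa>"
  by (induction I rule: infinite_finite_induct) (auto intro: cone_algebra.intros)

text \<open>The Leibniz expansion is a polynomial in the entries. Together with
  \<open>cone_algebra_if\<close>, which handles the replaced column, this puts the numerators and
  denominators of Cramer's rule into the algebra.\<close>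

lemma cone_algebra_det:
  fixes A :: "complex ^ 'n::finite \<Rightarrow> complex ^ 'm::finite ^ 'm"
  assumes "\<And>i j. (\<lambda>q. A q $ i $ j) \<in> cone_algebra \<kappa>"
  shows "(\<lambda>q. det (A q)) \<in> cone_algebra \<kappa>"
  unfolding det_def
  by (intro cone_algebra_sum cone_algebra_prod cone_algebra.mult cone_algebra.const assms)

lemma cone_algebra_if:
  "f \<in> cone_algebra \<kappa> \<Longrightarrow> g \<in> cone_algebra \<kappa> \<Longrightarrow> (\<lambda>q. if b then f q else g q) \<in> cone_algebra \<kappa>"
  by (cases b) simp_all

section \<open>Differentiation under the integral and within the algebra\<close>

context index_set
begin

lemma convex_pos_cone: "convex (pos_cone \<kappa>)"
proof (rule convexI)
  fix q r and u v :: real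
  assume q: "q \<in> pos_cone \<kappa>" "r \<in> pos_cone \<kappa>" and uv: "0 \<le> u" "0 \<le> v" "u + v = 1"
  have "u *\<^sub>R q + v *\<^sub>R r \<in> herm_space \<kappa>"
    using q by (intro subspace_add subspace_mul subspace_herm_space) (auto simp: pos_cone_def)
  moreover have "0 < u * Re (trig_poly \<kappa> q \<theta>) + v * Re (trig_poly \<kappa> r \<theta>)" for \<theta>
  proof (cases "u = 0")
    case False
    with uv pos_cone_pos[OF q(1), of \<theta>] pos_cone_pos[OF q(2), of \<theta>] show ?thesis
      by (intro add_pos_nonneg) auto
  qed (use uv pos_cone_pos[OF q(2)] in simp)
  ultimately show "u *\<^sub>R q + v *\<^sub>R r \<in> pos_cone \<kappa>"
    by (simp add: pos_cone_def trig_poly_add trig_poly_scaleR)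
qed

lemma continuous_on_trig_poly_pair:
  "continuous_on S (\<lambda>(q, \<theta>). trig_poly \<kappa> q \<theta>)"
proof -
  have "continuous_on S (\<lambda>x :: (complex ^ 'n) \<times> (real ^ 'd). chr k (snd x))" for k
    by (rule continuous_on_compose2[OF continuous_on_chr[of UNIV]]) (auto intro!: continuous_intros)
  then show ?thesis
    unfolding trig_poly_chr case_prod_unfold by (intro continuous_intros)
qed

text \<open>Each partial derivative multiplies \<phi> by a character and a constant and raises the
  exponent of Q by one, so it is again of the form \<open>int\<close>. An arbitrary numerator and
  exponent are what make this family stable.\<close>

lemma has_derivative_integral_quotient:
  assumes \<phi>: "continuous_on UNIV \<phi>" and q: "q \<in> pos_cone \<kappa>"
  shows "((\<lambda>q. integral cube (\<lambda>\<theta>. \<phi> \<theta> / trig_poly \<kappa> q \<theta> ^ n)) has_derivative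
    (\<lambda>v. \<Sum>i\<in>UNIV. integral cube (\<lambda>\<theta>. - of_nat n * \<phi> \<theta> * chr (\<kappa> i) \<theta> / trig_poly \<kappa> q \<theta> ^ Suc n) * v $ i))
    (at q within pos_cone \<kappa>)"
proof -
  let ?a = "\<lambda>q \<theta>. - of_nat n * \<phi> \<theta> / trig_poly \<kappa> q \<theta> ^ Suc n"
  \<comment> \<open>\<open>leibniz_rule\<close> asks for the derivative as a jointly continuous map
    into the bounded linear functions.\<close>
  define D where "D q \<theta> = Blinfun (\<lambda>v. ?a q \<theta> * trig_poly \<kappa> v \<theta>)" for q \<theta>
  have D: "blinfun_apply (D q \<theta>) v = ?a q \<theta> * trig_poly \<kappa> v \<theta>" for q \<theta> v
    unfolding D_def
    by (subst bounded_linear_Blinfun_apply)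
      (rule bounded_linear_const_mult[OF bounded_linear_trig_poly], rule refl)
  have der: "((\<lambda>q. \<phi> \<theta> / trig_poly \<kappa> q \<theta> ^ n) has_derivative blinfun_apply (D q \<theta>)) (at q within pos_cone \<kappa>)"
    if "q \<in> pos_cone \<kappa>" for q \<theta>
  proof -
    have nz: "trig_poly \<kappa> q \<theta> \<noteq> 0" by (rule pos_cone_nonzero[OF that])
    have tp: "((\<lambda>q. trig_poly \<kappa> q \<theta>) has_derivative (\<lambda>v. trig_poly \<kappa> v \<theta>)) (at q within pos_cone \<kappa>)"
      by (rule bounded_linear_imp_has_derivative) (rule bounded_linear_trig_poly)
    have "((\<lambda>q. \<phi> \<theta> * inverse (trig_poly \<kappa> q \<theta>) ^ n) has_derivative
        (\<lambda>v. \<phi> \<theta> * (of_nat n * (- (inverse (trig_poly \<kappa> q \<theta>) * trig_poly \<kappa> v \<theta> * inverse (trig_poly \<kappa> q \<theta>)))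
          * inverse (trig_poly \<kappa> q \<theta>) ^ (n - 1)))) (at q within pos_cone \<kappa>)"
      by (intro has_derivative_mult_right has_derivative_power Deriv.has_derivative_inverse nz tp)
    \<comment> \<open>For n = 0 the exponent n - 1 is truncated to 0, but the factor n makes both
      sides vanish.\<close>
    moreover have "\<phi> \<theta> * (of_nat n * (- (inverse (trig_poly \<kappa> q \<theta>) * trig_poly \<kappa> v \<theta> * inverse (trig_poly \<kappa> q \<theta>)))
          * inverse (trig_poly \<kappa> q \<theta>) ^ (n - 1)) = blinfun_apply (D q \<theta>) v" for v
      unfolding D using nz by (cases n) (simp_all add: field_simps)
    ultimately show ?thesis by (simp add: divide_inverse power_inverse)
  qed
  have cont: "continuous_on (pos_cone \<kappa> \<times> cube) (\<lambda>(q, \<theta>). D q \<theta>)"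
  proof (rule continuous_on_blinfun_componentwise)
    fix b :: "complex ^ 'n"
    have b: "continuous_on (pos_cone \<kappa> \<times> cube) (\<lambda>x. trig_poly \<kappa> b (snd x))"
      by (rule continuous_on_compose2[OF continuous_on_trig_poly[of UNIV]]) (auto intro!: continuous_intros)
    show "continuous_on (pos_cone \<kappa> \<times> cube) (\<lambda>x. blinfun_apply (case x of (q, \<theta>) \<Rightarrow> D q \<theta>) b)"
      unfolding D case_prod_unfold
      by (intro continuous_intros continuous_on_compose2[OF \<phi>] b
          continuous_on_trig_poly_pair[unfolded case_prod_unfold])
        (auto simp: pos_cone_nonzero)
  qed
  have cq: "continuous_on cube (\<lambda>\<theta>. \<phi> \<theta> / trig_poly \<kappa> q \<theta> ^ n)" if "q \<in> pos_cone \<kappa>" for q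
    by (intro continuous_intros continuous_on_subset[OF \<phi>]) (auto simp: pos_cone_nonzero that)
  have L: "((\<lambda>q. integral cube (\<lambda>\<theta>. \<phi> \<theta> / trig_poly \<kappa> q \<theta> ^ n)) has_derivative integral cube (D q))
     (at q within pos_cone \<kappa>)"
    by (rule leibniz_rule[OF der _ cont q convex_pos_cone]) (auto intro!: integrable_continuous cq)
  have Dint: "D q integrable_on cube"
    using continuous_on_compose2[OF cont continuous_on_Pair[OF continuous_on_const continuous_on_id], of q cube] q
    by (intro integrable_continuous) auto
  have "blinfun_apply (integral cube (D q)) v =
     (\<Sum>i\<in>UNIV. integral cube (\<lambda>\<theta>. - of_nat n * \<phi> \<theta> * chr (\<kappa> i) \<theta> / trig_poly \<kappa> q \<theta> ^ Suc n) * v $ i)" for v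
  proof -
    have "blinfun_apply (integral cube (D q)) v = integral cube (\<lambda>\<theta>. ?a q \<theta> * trig_poly \<kappa> v \<theta>)"
      by (simp only: blinfun_apply_integral[OF Dint] D)
    also have "\<dots> = integral cube (\<lambda>\<theta>. \<Sum>i\<in>UNIV. - of_nat n * \<phi> \<theta> * chr (\<kappa> i) \<theta> / trig_poly \<kappa> q \<theta> ^ Suc n * v $ i)"
      by (simp add: trig_poly_chr[of \<kappa> v] sum_distrib_left sum_divide_distrib sum_negf mult_ac)
    also have "\<dots> = (\<Sum>i\<in>UNIV. integral cube (\<lambda>\<theta>. - of_nat n * \<phi> \<theta> * chr (\<kappa> i) \<theta> / trig_poly \<kappa> q \<theta> ^ Suc n * v $ i))"
      by (intro integral_sum finite integrable_continuous continuous_intros continuous_on_subset[OF \<phi>])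
        (auto simp: pos_cone_nonzero q)
    finally show ?thesis by (simp only: integral_mult_left)
  qed
  then have "blinfun_apply (integral cube (D q)) =
     (\<lambda>v. \<Sum>i\<in>UNIV. integral cube (\<lambda>\<theta>. - of_nat n * \<phi> \<theta> * chr (\<kappa> i) \<theta> / trig_poly \<kappa> q \<theta> ^ Suc n) * v $ i)"
    by (rule ext)
  with L show ?thesis by simp
qed

lemma cone_algebra_has_derivative:
  assumes "f \<in> cone_algebra \<kappa>"
  shows "\<exists>g. (\<forall>i. g i \<in> cone_algebra \<kappa>) \<and>
    (\<forall>q\<in>pos_cone \<kappa>. (f has_derivative (\<lambda>v. \<Sum>i\<in>UNIV. g i q * v $ i)) (at q within pos_cone \<kappa>))"
  using assms
proof induction
  case (const c)
  show ?case
    by (rule exI[of _ "\<lambda>i q. 0"]) (auto intro: cone_algebra.const)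
next
  case (coord i)
  have "(\<Sum>j\<in>UNIV. (if j = i then 1 else 0) * v $ j) = v $ i" for v :: "complex ^ 'n"
    by (simp add: mult_delta_left)
  then show ?case
    by (intro exI[of _ "\<lambda>j q. if j = i then 1 else 0"])
      (auto intro!: cone_algebra.const bounded_linear_imp_has_derivative bounded_linear_vec_nth)
next
  case (int \<phi> n)
  then have "(\<lambda>q. integral cube (\<lambda>\<theta>. (- of_nat n * \<phi> \<theta> * chr (\<kappa> i) \<theta>) / trig_poly \<kappa> q \<theta> ^ Suc n)) \<in> cone_algebra \<kappa>" for i
    by (intro cone_algebra.int continuous_intros)
  with has_derivative_integral_quotient[OF int] show ?case
    by (intro exI[of _ "\<lambda>i q. integral cube (\<lambda>\<theta>. (- of_nat n * \<phi> \<theta> * chr (\<kappa> i) \<theta>) / trig_poly \<kappa> q \<theta> ^ Suc n)"]) blast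
next
  case (add f1 f2)
  from add.IH obtain g1 g2 where g: "\<And>i. g1 i \<in> cone_algebra \<kappa>" "\<And>i. g2 i \<in> cone_algebra \<kappa>"
    "\<And>q. q \<in> pos_cone \<kappa> \<Longrightarrow> (f1 has_derivative (\<lambda>v. \<Sum>i\<in>UNIV. g1 i q * v $ i)) (at q within pos_cone \<kappa>)"
    "\<And>q. q \<in> pos_cone \<kappa> \<Longrightarrow> (f2 has_derivative (\<lambda>v. \<Sum>i\<in>UNIV. g2 i q * v $ i)) (at q within pos_cone \<kappa>)"
    by blast
  have "((\<lambda>q. f1 q + f2 q) has_derivative (\<lambda>v. \<Sum>i\<in>UNIV. (g1 i q + g2 i q) * v $ i)) (at q within pos_cone \<kappa>)"
    if "q \<in> pos_cone \<kappa>" for q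
    by (rule has_derivative_eq_rhs[OF has_derivative_add[OF g(3,4)[OF that]]])
      (simp add: fun_eq_iff distrib_right sum.distrib)
  moreover have "(\<lambda>q. g1 i q + g2 i q) \<in> cone_algebra \<kappa>" for i
    by (intro cone_algebra.add g)
  ultimately show ?case by (intro exI[of _ "\<lambda>i q. g1 i q + g2 i q"]) blast
next
  case (mult f1 f2)
  from mult.IH obtain g1 g2 where g: "\<And>i. g1 i \<in> cone_algebra \<kappa>" "\<And>i. g2 i \<in> cone_algebra \<kappa>"
    "\<And>q. q \<in> pos_cone \<kappa> \<Longrightarrow> (f1 has_derivative (\<lambda>v. \<Sum>i\<in>UNIV. g1 i q * v $ i)) (at q within pos_cone \<kappa>)"
    "\<And>q. q \<in> pos_cone \<kappa> \<Longrightarrow> (f2 has_derivative (\<lambda>v. \<Sum>i\<in>UNIV. g2 i q * v $ i)) (at q within pos_cone \<kappa>)"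
    by blast
  have "((\<lambda>q. f1 q * f2 q) has_derivative (\<lambda>v. \<Sum>i\<in>UNIV. (f1 q * g2 i q + g1 i q * f2 q) * v $ i))
      (at q within pos_cone \<kappa>)"
    if "q \<in> pos_cone \<kappa>" for q
    by (rule has_derivative_eq_rhs[OF has_derivative_mult[OF g(3,4)[OF that]]])
      (simp add: fun_eq_iff distrib_left distrib_right sum.distrib sum_distrib_left sum_distrib_right mult_ac)
  moreover have "(\<lambda>q. f1 q * g2 i q + g1 i q * f2 q) \<in> cone_algebra \<kappa>" for i
    by (intro cone_algebra.add cone_algebra.mult g mult.hyps)
  ultimately show ?case by (intro exI[of _ "\<lambda>i q. f1 q * g2 i q + g1 i q * f2 q"]) blast
next
  case (inverse f)
  from inverse.IH obtain g where g: "\<And>i. g i \<in> cone_algebra \<kappa>"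
    "\<And>q. q \<in> pos_cone \<kappa> \<Longrightarrow> (f has_derivative (\<lambda>v. \<Sum>i\<in>UNIV. g i q * v $ i)) (at q within pos_cone \<kappa>)"
    by blast
  \<comment> \<open>The sign is written as a product with - 1, since the algebra is generated by
    sums and products, with no rule for negation.\<close>
  have "((\<lambda>q. inverse (f q)) has_derivative (\<lambda>v. \<Sum>i\<in>UNIV. (- 1 * (inverse (f q) * g i q * inverse (f q))) * v $ i))
      (at q within pos_cone \<kappa>)"
    if "q \<in> pos_cone \<kappa>" for q
    by (rule has_derivative_eq_rhs[OF Deriv.has_derivative_inverse[OF inverse.hyps(2)[OF that] g(2)[OF that]]])
      (simp add: fun_eq_iff sum_distrib_left sum_distrib_right sum_negf mult_ac)
  moreover have "(\<lambda>q. - 1 * (inverse (f q) * g i q * inverse (f q))) \<in> cone_algebra \<kappa>" for i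
    by (intro cone_algebra.mult cone_algebra.inverse cone_algebra.const g inverse.hyps)
  ultimately show ?case
    by (intro exI[of _ "\<lambda>i q. - 1 * (inverse (f q) * g i q * inverse (f q))"]) blast
qed

end

section \<open>The inverse of the moment map\<close>

context moment_problem
begin

text \<open>The dependence of Q on q is complex linear, hence so is the derivative, and a complex
  matrix describes it. The forms \<open>of_nat 1\<close> and \<open>Suc 1\<close> match the case n =
  1 of \<open>has_derivative_integral_quotient\<close> literally.\<close>

definition jac :: "complex ^ 'n \<Rightarrow> complex ^ 'n ^ 'n" where
  "jac q = (\<chi> i j. complex_of_real dm_const * integral cube
    (\<lambda>\<theta>. - of_nat 1 * (cnj (chr (\<kappa> i) \<theta>) * trig_poly \<kappa> p \<theta>) * chr (\<kappa> j) \<theta> / trig_poly \<kappa> q \<theta> ^ Suc 1))"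

lemma moment_map_nth':
  assumes "q \<in> pos_cone \<kappa>"
  shows "moment_map \<kappa> p q $ i = complex_of_real dm_const * integral cube
    (\<lambda>\<theta>. (cnj (chr (\<kappa> i) \<theta>) * trig_poly \<kappa> p \<theta>) / trig_poly \<kappa> q \<theta> ^ 1)"
  by (simp add: moment_map_nth[OF assms] scaleR_conv_of_real)

lemma continuous_on_cnj_chr_trig_poly:
  "continuous_on S (\<lambda>\<theta>. cnj (chr k \<theta>) * trig_poly \<kappa> p \<theta>)"
  by (intro continuous_intros)

lemma has_derivative_moment_map:
  assumes q: "q \<in> pos_cone \<kappa>"
  shows "(moment_map \<kappa> p has_derivative (\<lambda>v. jac q *v v)) (at q within pos_cone \<kappa>)"
proof (rule has_derivative_vec_componentwise)
  fix i
  let ?F = "\<lambda>q. complex_of_real dm_const * integral cube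
    (\<lambda>\<theta>. (cnj (chr (\<kappa> i) \<theta>) * trig_poly \<kappa> p \<theta>) / trig_poly \<kappa> q \<theta> ^ 1)"
  have "(?F has_derivative (\<lambda>v. (jac q *v v) $ i)) (at q within pos_cone \<kappa>)"
    by (rule has_derivative_eq_rhs[OF has_derivative_mult_right[OF
          has_derivative_integral_quotient[OF continuous_on_cnj_chr_trig_poly q]]])
      (simp add: fun_eq_iff jac_def matrix_vector_mult_def sum_distrib_left mult.assoc)
  then show "((\<lambda>q. moment_map \<kappa> p q $ i) has_derivative (\<lambda>v. (jac q *v v) $ i)) (at q within pos_cone \<kappa>)"
    by (rule has_derivative_transform[OF q moment_map_nth', rotated])
qed

text \<open>Pairing \<open>jac q *v v\<close> with v itself gives minus the integral of P
  \<bar>V\<bar>^2 / Q^2, up to the positive constant \<open>dm_const\<close>, where V is the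
  polynomial of v. As v may be any complex vector, V need not be real, hence the conjugate; in
  return the complex determinant is nonzero.\<close>

lemma jac_injective:
  assumes q: "q \<in> pos_cone \<kappa>" and v: "jac q *v v = 0"
  shows "v = 0"
proof -
  let ?P = "\<lambda>\<theta>. Re (trig_poly \<kappa> p \<theta>)" and ?Q = "\<lambda>\<theta>. Re (trig_poly \<kappa> q \<theta>)"
  let ?f = "\<lambda>\<theta>. trig_poly \<kappa> p \<theta> * trig_poly \<kappa> v \<theta> / trig_poly \<kappa> q \<theta> ^ 2"
  have cf: "continuous_on S ?f" for S
    by (intro continuous_intros) (simp add: pos_cone_nonzero[OF q])
  have row: "(jac q *v v) $ i = - complex_of_real dm_const * integral cube (\<lambda>\<theta>. cnj (chr (\<kappa> i) \<theta>) * ?f \<theta>)" for i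
  proof -
    let ?g = "\<lambda>j \<theta>. - of_nat 1 * (cnj (chr (\<kappa> i) \<theta>) * trig_poly \<kappa> p \<theta>) * chr (\<kappa> j) \<theta> / trig_poly \<kappa> q \<theta> ^ Suc 1"
    have "(jac q *v v) $ i = complex_of_real dm_const * (\<Sum>j\<in>UNIV. integral cube (\<lambda>\<theta>. ?g j \<theta> * v $ j))"
      by (simp only: jac_def matrix_vector_mult_def vec_lambda_beta integral_mult_left
          sum_distrib_left mult.assoc)
    also have "(\<Sum>j\<in>UNIV. integral cube (\<lambda>\<theta>. ?g j \<theta> * v $ j)) = integral cube (\<lambda>\<theta>. \<Sum>j\<in>UNIV. ?g j \<theta> * v $ j)"
      by (intro integral_sum[symmetric] finite integrable_continuous continuous_intros)
        (simp add: pos_cone_nonzero[OF q])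
    also have "(\<lambda>\<theta>. \<Sum>j\<in>UNIV. ?g j \<theta> * v $ j) = (\<lambda>\<theta>. - (cnj (chr (\<kappa> i) \<theta>) * ?f \<theta>))"
      by (simp add: fun_eq_iff trig_poly_chr[of \<kappa> v] sum_distrib_left sum_divide_distrib sum_negf
          power2_eq_square mult_ac)
    finally show ?thesis by simp
  qed
  have "0 = (\<Sum>i\<in>UNIV. integral cube (\<lambda>\<theta>. cnj (chr (\<kappa> i) \<theta>) * ?f \<theta>) * cnj (v $ i))"
    using row dm_const_pos v by (intro sum.neutral[symmetric]) auto
  also have "\<dots> = integral cube (\<lambda>\<theta>. ?f \<theta> * cnj (trig_poly \<kappa> v \<theta>))"
    by (rule sum_integral_chr[OF cf])
  finally have "0 = Re (integral cube (\<lambda>\<theta>. ?f \<theta> * cnj (trig_poly \<kappa> v \<theta>)))" by (metis zero_complex.simps(1))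
  also have "\<dots> = integral cube (\<lambda>\<theta>. Re (?f \<theta> * cnj (trig_poly \<kappa> v \<theta>)))"
    by (intro Re_integral integrable_continuous continuous_on_mult cf continuous_intros)
  also have "(\<lambda>\<theta>. Re (?f \<theta> * cnj (trig_poly \<kappa> v \<theta>))) =
      (\<lambda>\<theta>. ?P \<theta> * (norm (trig_poly \<kappa> v \<theta>))\<^sup>2 / (?Q \<theta>)\<^sup>2)" (is "_ = ?h")
  proof
    fix \<theta>
    have "?f \<theta> * cnj (trig_poly \<kappa> v \<theta>) =
        trig_poly \<kappa> p \<theta> * (trig_poly \<kappa> v \<theta> * cnj (trig_poly \<kappa> v \<theta>)) / (trig_poly \<kappa> q \<theta>)\<^sup>2"
      by simp
    also have "\<dots> = complex_of_real (?h \<theta>)"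
      by (simp only: complex_norm_square[symmetric] of_real_divide of_real_mult of_real_power
          of_real_Re_trig_poly pos_cone_herm p q)
    finally show "Re (?f \<theta> * cnj (trig_poly \<kappa> v \<theta>)) = ?h \<theta>" by (metis Re_complex_of_real)
  qed
  finally have int0: "integral cube ?h = 0" by simp
  have Q: "?Q \<theta> > 0" "?P \<theta> > 0" for \<theta> using pos_cone_pos p q by auto
  show ?thesis
  proof (rule trig_poly_eq_0[OF inj], rule ccontr)
    fix \<theta> assume "\<theta> \<in> torus" "trig_poly \<kappa> v \<theta> \<noteq> 0"
    then have "0 < integral cube ?h"
      using torus_subset_cube Q less_imp_neq[OF Q(1)] less_imp_neq[OF Q(2)]
      by (intro integral_cube_pos[of _ \<theta>] continuous_intros) (auto simp: less_imp_le)
    with int0 show False by simp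
  qed
qed

lemma det_jac:
  assumes "q \<in> pos_cone \<kappa>"
  shows "det (jac q) \<noteq> 0"
  using jac_injective[OF assms] matrix_left_invertible_ker[of "jac q"]
  by (metis invertible_det_nz invertible_left_inverse)

text \<open>Cramer's formula: the explicit quotient of determinants is visibly in the algebra, once
  \<open>det_jac\<close> permits the inversion.\<close>

definition jac_inv :: "complex ^ 'n \<Rightarrow> complex ^ 'n \<Rightarrow> complex ^ 'n" where
  "jac_inv q v = (\<chi> k. det (\<chi> i j. if j = k then v $ i else jac q $ i $ j) / det (jac q))"

lemma jac_inv:
  assumes "q \<in> pos_cone \<kappa>"
  shows "jac q *v jac_inv q v = v" and "jac_inv q (jac q *v v) = v"
  using cramer[OF det_jac[OF assms]] unfolding jac_inv_def by metis+

lemma bounded_linear_jac_inv: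
  assumes q: "q \<in> pos_cone \<kappa>"
  shows "bounded_linear (jac_inv q)"
proof -
  have *: "jac_inv q u = v \<longleftrightarrow> jac q *v v = u" for u v
    using jac_inv[OF q] by metis
  have "linear (jac_inv q)"
  proof (rule linearI)
    show "jac_inv q (u + v) = jac_inv q u + jac_inv q v" for u v
      by (simp add: * matrix_vector_right_distrib jac_inv[OF q])
    have "jac q *v (a *\<^sub>R v) = a *\<^sub>R (jac q *v v)" for a v
      by (simp add: matrix_vector_mult_def vec_eq_iff scaleR_sum_right)
    then show "jac_inv q (a *\<^sub>R v) = a *\<^sub>R jac_inv q v" for a v
      by (simp only: * jac_inv(1)[OF q])
  qed
  then show ?thesis by (rule linear_conv_bounded_linear[THEN iffD1])
qed

lemma jac_cone_algebra: "(\<lambda>q. jac q $ i $ j) \<in> cone_algebra \<kappa>"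
  unfolding jac_def vec_lambda_beta
  by (intro cone_algebra.mult cone_algebra.const cone_algebra.int continuous_intros)

lemma jac_inv_cone_algebra: "(\<lambda>q. jac_inv q v $ k) \<in> cone_algebra \<kappa>"
  unfolding jac_inv_def vec_lambda_beta divide_inverse
  by (intro cone_algebra.mult cone_algebra.inverse cone_algebra_det det_jac jac_cone_algebra)
    (simp_all add: cone_algebra_if cone_algebra.const jac_cone_algebra)

lemma cone_algebra_has_derivative_family:
  assumes "\<And>i :: 'n. h i \<in> cone_algebra \<kappa>"
  obtains g where "\<And>i j. g i j \<in> cone_algebra \<kappa>"
    "\<And>i q. q \<in> pos_cone \<kappa> \<Longrightarrow> (h i has_derivative (\<lambda>v. \<Sum>j\<in>UNIV. g i j q * v $ j)) (at q within pos_cone \<kappa>)"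
proof -
  have "\<forall>i. \<exists>g. (\<forall>j. g j \<in> cone_algebra \<kappa>) \<and>
    (\<forall>q\<in>pos_cone \<kappa>. (h i has_derivative (\<lambda>v. \<Sum>j\<in>UNIV. g j q * v $ j)) (at q within pos_cone \<kappa>))"
    by (intro allI cone_algebra_has_derivative assms)
  from choice[OF this] that show thesis by blast
qed

text \<open>The invariant asks for agreement with the algebra on the cone only, because
  \<open>moment_map_nth'\<close> rests on the continuity of P / Q, which holds there.\<close>

lemma smooth_on_moment_map: "smooth_on V (pos_cone \<kappa>) (moment_map \<kappa> p)"
proof (rule smooth_on_coinduct[where S = "{f. \<forall>i. \<exists>h\<in>cone_algebra \<kappa>. \<forall>q\<in>pos_cone \<kappa>. f q $ i = h q}"])
  have F: "(\<lambda>q. complex_of_real dm_const * integral cube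
      (\<lambda>\<theta>. (cnj (chr (\<kappa> i) \<theta>) * trig_poly \<kappa> p \<theta>) / trig_poly \<kappa> q \<theta> ^ 1)) \<in> cone_algebra \<kappa>" for i
    by (intro cone_algebra.mult cone_algebra.const cone_algebra.int continuous_on_cnj_chr_trig_poly)
  show "moment_map \<kappa> p \<in> {f. \<forall>i. \<exists>h\<in>cone_algebra \<kappa>. \<forall>q\<in>pos_cone \<kappa>. f q $ i = h q}"
  proof (intro CollectI allI)
    show "\<exists>h\<in>cone_algebra \<kappa>. \<forall>q\<in>pos_cone \<kappa>. moment_map \<kappa> p q $ i = h q" for i
      by (rule bexI[OF _ F[of i]]) (intro ballI moment_map_nth')
  qed
next
  fix f :: "complex ^ 'n \<Rightarrow> complex ^ 'n"
  assume "f \<in> {f. \<forall>i. \<exists>h\<in>cone_algebra \<kappa>. \<forall>q\<in>pos_cone \<kappa>. f q $ i = h q}"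
  then obtain h where h: "\<And>i. h i \<in> cone_algebra \<kappa>" "\<And>i q. q \<in> pos_cone \<kappa> \<Longrightarrow> f q $ i = h i q"
    by simp metis
  obtain g where g: "\<And>i j. g i j \<in> cone_algebra \<kappa>"
    "\<And>i q. q \<in> pos_cone \<kappa> \<Longrightarrow> (h i has_derivative (\<lambda>v. \<Sum>j\<in>UNIV. g i j q * v $ j)) (at q within pos_cone \<kappa>)"
    using cone_algebra_has_derivative_family[of h] h(1) by blast
  define f' where "f' q v = (\<chi> i. \<Sum>j\<in>UNIV. g i j q * v $ j)" for q v
  have "(f has_derivative f' q) (at q within pos_cone \<kappa>)" if "q \<in> pos_cone \<kappa>" for q
  proof (rule has_derivative_vec_componentwise)
    show "((\<lambda>q. f q $ i) has_derivative (\<lambda>v. f' q v $ i)) (at q within pos_cone \<kappa>)" for i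
      by (rule has_derivative_transform[OF that h(2)]) (use g(2)[OF that] in \<open>simp_all add: f'_def\<close>)
  qed
  moreover have "(\<lambda>q. \<Sum>j\<in>UNIV. g i j q * v $ j) \<in> cone_algebra \<kappa>" for i v
    by (intro cone_algebra_sum cone_algebra.mult cone_algebra.const g)
  then have "(\<lambda>q. f' q v) \<in> {f. \<forall>i. \<exists>h\<in>cone_algebra \<kappa>. \<forall>q\<in>pos_cone \<kappa>. f q $ i = h q}" for v
    unfolding f'_def by auto
  ultimately show "\<exists>f'. (\<forall>q\<in>pos_cone \<kappa>. (f has_derivative f' q) (at q within pos_cone \<kappa>)) \<and>
      (\<forall>v. (\<lambda>q. f' q v) \<in> {f. \<forall>i. \<exists>h\<in>cone_algebra \<kappa>. \<forall>q\<in>pos_cone \<kappa>. f q $ i = h q})"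
    by blast
qed

section \<open>Regularity of the inverse and the image of the cone\<close>

lemma continuous_on_moment_map: "continuous_on (pos_cone \<kappa>) (moment_map \<kappa> p)"
  by (rule has_derivative_continuous_on) (rule has_derivative_moment_map)

text \<open>By the chain rule a derivative of \<open>h \<circ> G\<close> is again of the form \<open>k \<circ> G\<close> with \<open>k\<close> in the algebra,
  since the derivative of \<open>G\<close> at \<open>y\<close> is the inverse Jacobian at \<open>G y\<close>.\<close>

lemma smooth_on_right_inverse:
  assumes G: "continuous_on W G" "G ` W \<subseteq> pos_cone \<kappa>" "\<And>y. y \<in> W \<Longrightarrow> moment_map \<kappa> p (G y) = y"
  shows "smooth_on V W G"
proof (rule smooth_on_coinduct[where S = "{f. \<forall>i. \<exists>h\<in>cone_algebra \<kappa>. \<forall>y. f y $ i = h (G y)}"])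
  show "G \<in> {f. \<forall>i. \<exists>h\<in>cone_algebra \<kappa>. \<forall>y. f y $ i = h (G y)}"
    by (auto intro!: bexI[OF _ cone_algebra.coord])
next
  fix f :: "complex ^ 'n \<Rightarrow> complex ^ 'n"
  assume "f \<in> {f. \<forall>i. \<exists>h\<in>cone_algebra \<kappa>. \<forall>y. f y $ i = h (G y)}"
  then have "\<forall>i. \<exists>h. h \<in> cone_algebra \<kappa> \<and> (\<forall>y. f y $ i = h (G y))"
    by (simp add: Bex_def)
  then obtain h where "\<forall>i. h i \<in> cone_algebra \<kappa> \<and> (\<forall>y. f y $ i = h i (G y))"
    by (rule choice[THEN exE])
  then have h: "\<And>i. h i \<in> cone_algebra \<kappa>" "\<And>i y. f y $ i = h i (G y)" by blast+
  obtain g where g: "\<And>i j. g i j \<in> cone_algebra \<kappa>"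
    "\<And>i q. q \<in> pos_cone \<kappa> \<Longrightarrow> (h i has_derivative (\<lambda>v. \<Sum>j\<in>UNIV. g i j q * v $ j)) (at q within pos_cone \<kappa>)"
    using cone_algebra_has_derivative_family[of h] h(1) by blast
  define f' where "f' y v = (\<chi> i. \<Sum>j\<in>UNIV. g i j (G y) * jac_inv (G y) v $ j)" for y v
  have "(f has_derivative f' y) (at y within W)" if y: "y \<in> W" for y
  proof (rule has_derivative_vec_componentwise)
    fix i
    have Gy: "G y \<in> pos_cone \<kappa>" using G(2) y by blast
    have "(G has_derivative jac_inv (G y)) (at y within W)"
      by (rule has_derivative_inverse_within[OF has_derivative_moment_map[OF Gy]
            bounded_linear_jac_inv[OF Gy] jac_inv(2)[OF Gy] G y])
    moreover have "(h i has_derivative (\<lambda>v. \<Sum>j\<in>UNIV. g i j (G y) * v $ j)) (at (G y) within G ` W)"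
      by (rule has_derivative_subset[OF g(2)[OF Gy] G(2)])
    ultimately have "(h i \<circ> G has_derivative (\<lambda>v. \<Sum>j\<in>UNIV. g i j (G y) * v $ j) \<circ> jac_inv (G y)) (at y within W)"
      by (rule diff_chain_within)
    then show "((\<lambda>y. f y $ i) has_derivative (\<lambda>v. f' y v $ i)) (at y within W)"
      by (simp add: h(2) f'_def o_def)
  qed
  moreover have "(\<lambda>q. \<Sum>j\<in>UNIV. g i j q * jac_inv q v $ j) \<in> cone_algebra \<kappa>" for i v
    by (intro cone_algebra_sum cone_algebra.mult jac_inv_cone_algebra g)
  then have "(\<lambda>y. f' y v) \<in> {f. \<forall>i. \<exists>h\<in>cone_algebra \<kappa>. \<forall>y. f y $ i = h (G y)}" for v
    unfolding f'_def by fastforce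
  ultimately show "\<exists>f'. (\<forall>y\<in>W. (f has_derivative f' y) (at y within W)) \<and>
      (\<forall>v. (\<lambda>y. f' y v) \<in> {f. \<forall>i. \<exists>h\<in>cone_algebra \<kappa>. \<forall>y. f y $ i = h (G y)})"
    by blast
qed

text \<open>Used with S the whole cone for the openness of the image, and with arbitrary relatively
  open S for the continuity of the inverse.\<close>

lemma openin_moment_map_image:
  assumes "openin (top_of_set (herm_space \<kappa>)) S" "S \<subseteq> pos_cone \<kappa>"
  shows "openin (top_of_set (herm_space \<kappa>)) (moment_map \<kappa> p ` S)"
proof (rule invariance_of_domain_subspaces[OF assms(1) subspace_herm_space subspace_herm_space order_refl])
  show "continuous_on S (moment_map \<kappa> p)"
    by (rule continuous_on_subset[OF continuous_on_moment_map assms(2)])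
  show "moment_map \<kappa> p \<in> S \<rightarrow> herm_space \<kappa>"
    using assms(2) moment_map_herm by blast
  show "inj_on (moment_map \<kappa> p) S"
    by (rule inj_on_subset[OF inj_on_moment_map assms(2)])
qed

lemma moment_map_image_closed:
  assumes d: "CARD('d) \<le> 2" and i: "\<kappa> i = 0"
    and c: "c \<in> dual_cone \<kappa>" "c \<in> closure (moment_map \<kappa> p ` pos_cone \<kappa>)"
  shows "c \<in> moment_map \<kappa> p ` pos_cone \<kappa>"
proof -
  obtain \<delta> where \<delta>: "0 < \<delta>"
    "\<And>c' q. dist c' c < \<delta> \<Longrightarrow> q \<in> closure (pos_cone \<kappa>) \<Longrightarrow> \<delta> * norm q \<le> c' \<bullet> q"
    using dual_cone_coercive[OF c(1)] by blast
  \<comment> \<open>This is the bound on norm q that follows from \<delta> * norm q \<le>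
    \<langle>f(q), q\<rangle> = \<open>dm_const\<close> times the integral of P.\<close>
  define R where "R = dm_const * integral cube (\<lambda>\<theta>. Re (trig_poly \<kappa> p \<theta>)) / \<delta>"
  obtain \<epsilon> where \<epsilon>: "0 < \<epsilon>" "\<And>q \<theta>. \<lbrakk>q \<in> pos_cone \<kappa>; norm q \<le> R;
      Re (moment_map \<kappa> p q $ i) \<le> norm c + \<delta>\<rbrakk> \<Longrightarrow> \<epsilon> \<le> Re (trig_poly \<kappa> q \<theta>)"
    using moment_map_proper[OF d i, of R "norm c + \<delta>"] by blast
  \<comment> \<open>The uniform bound \<epsilon> makes K closed and yet contained in the open cone.
    K is thus compact with closed image, and every q whose image is within \<delta> of c lies in
    it.\<close>
  define K where "K = herm_space \<kappa> \<inter> cball 0 R \<inter> (\<Inter>\<theta>. {q. \<epsilon> \<le> Re (trig_poly \<kappa> q \<theta>)})"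
  have "closed K"
    unfolding K_def
    by (intro closed_Int closed_INT ballI closed_herm_space closed_cball closed_Collect_le
        continuous_intros continuous_on_trig_poly_coeff)
  moreover have "bounded K" unfolding K_def by (meson bounded_Int bounded_cball)
  ultimately have "compact K" by (simp add: compact_eq_bounded_closed)
  moreover have KU: "K \<subseteq> pos_cone \<kappa>"
    using \<epsilon>(1) by (fastforce simp: K_def pos_cone_def intro: less_le_trans)
  ultimately have "compact (moment_map \<kappa> p ` K)"
    by (intro compact_continuous_image continuous_on_subset[OF continuous_on_moment_map])
  then have cl: "closed (moment_map \<kappa> p ` K)" by (rule compact_imp_closed)
  have near: "q \<in> K" if q: "q \<in> pos_cone \<kappa>" "dist (moment_map \<kappa> p q) c < \<delta>" for q
  proof -
    have nz: "Re (trig_poly \<kappa> q \<theta>) \<noteq> 0" for \<theta> using pos_cone_pos[OF q(1), of \<theta>] by simp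
    have "\<delta> * norm q \<le> moment_map \<kappa> p q \<bullet> q"
      using \<delta>(2)[OF q(2)] q(1) closure_subset by blast
    also have "\<dots> = dm_const * integral cube (\<lambda>\<theta>. Re (trig_poly \<kappa> p \<theta>))"
      by (simp add: moment_map_inner[OF q(1) pos_cone_herm[OF q(1)]] nz)
    finally have qR: "norm q \<le> R" using \<delta>(1) by (simp add: R_def field_simps)
    have "Re (moment_map \<kappa> p q $ i) \<le> norm (moment_map \<kappa> p q)"
      by (rule order_trans[OF complex_Re_le_cmod Finite_Cartesian_Product.norm_nth_le])
    also have "\<dots> \<le> norm c + \<delta>"
      using q(2) norm_triangle_sub[of "moment_map \<kappa> p q" c] by (simp add: dist_norm)
    finally show ?thesis
      using \<epsilon>(2)[OF q(1) qR] qR pos_cone_herm[OF q(1)] by (simp add: K_def)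
  qed
  have "c \<in> closure (moment_map \<kappa> p ` K)"
    unfolding closure_approachable
  proof (intro allI impI)
    fix e :: real assume "0 < e"
    with \<delta>(1) c(2) obtain q where "q \<in> pos_cone \<kappa>" "dist (moment_map \<kappa> p q) c < min e \<delta>"
      unfolding closure_approachable by (metis (no_types, opaque_lifting) imageE min_less_iff_conj)
    with near show "\<exists>y\<in>moment_map \<kappa> p ` K. dist y c < e" by auto
  qed
  with cl KU show ?thesis by auto
qed

lemma moment_map_image:
  assumes "CARD('d) \<le> 2" "\<kappa> i = 0"
  shows "moment_map \<kappa> p ` pos_cone \<kappa> = dual_cone \<kappa>"
proof -
  let ?I = "moment_map \<kappa> p ` pos_cone \<kappa>"
  have sub: "?I \<subseteq> dual_cone \<kappa>" using moment_map_dual_cone by blast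
  have dh: "dual_cone \<kappa> \<subseteq> herm_space \<kappa>" by (auto simp: dual_cone_def)
  have "openin (top_of_set (dual_cone \<kappa>)) ?I"
    using openin_moment_map_image[OF openin_pos_cone order_refl] sub dh
    by (rule openin_subset_trans)
  moreover have "?I = dual_cone \<kappa> \<inter> closure ?I"
  proof
    show "?I \<subseteq> dual_cone \<kappa> \<inter> closure ?I" using sub closure_subset by (rule Int_greatest)
    show "dual_cone \<kappa> \<inter> closure ?I \<subseteq> ?I"
      by (intro subsetI, elim IntE) (rule moment_map_image_closed[OF assms])
  qed
  then have "closedin (top_of_set (dual_cone \<kappa>)) ?I"
    by (metis closed_closure closedin_closed_Int)
  moreover have "?I \<noteq> {}" using p by blast
  ultimately show ?thesis
    using convex_connected[OF convex_dual_cone] unfolding connected_clopen by blast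
qed

lemma diffeomorphism_moment_map:
  assumes "CARD('d) \<le> 2" "\<kappa> i = 0"
  shows "diffeomorphism (herm_space \<kappa>) (pos_cone \<kappa>) (dual_cone \<kappa>) (moment_map \<kappa> p)"
  unfolding diffeomorphism_def
proof (intro conjI openin_pos_cone openin_dual_cone smooth_on_moment_map)
  let ?G = "inv_into (pos_cone \<kappa>) (moment_map \<kappa> p)"
  note im = moment_map_image[OF assms]
  show "bij_betw (moment_map \<kappa> p) (pos_cone \<kappa>) (dual_cone \<kappa>)"
    by (simp add: bij_betw_def inj_on_moment_map im)
  have "continuous_on (dual_cone \<kappa>) ?G"
  proof (rule continuous_on_inverse_open_map[OF continuous_on_moment_map im])
    show "?G (moment_map \<kappa> p q) = q" if "q \<in> pos_cone \<kappa>" for q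
      by (rule inv_into_f_f[OF inj_on_moment_map that])
    fix S assume S: "openin (top_of_set (pos_cone \<kappa>)) S"
    then have "openin (top_of_set (herm_space \<kappa>)) (moment_map \<kappa> p ` S)"
      using openin_trans[OF S openin_pos_cone] openin_imp_subset[OF S]
      by (intro openin_moment_map_image)
    then show "openin (top_of_set (dual_cone \<kappa>)) (moment_map \<kappa> p ` S)"
      by (rule openin_subset_trans) (use im openin_imp_subset[OF S] in \<open>auto simp: dual_cone_def\<close>)
  qed
  then show "smooth_on (herm_space \<kappa>) (dual_cone \<kappa>) ?G"
    by (rule smooth_on_right_inverse) (auto simp: im inv_into_into f_inv_into_f)
qed

end

theorem theorem4p4:
  fixes \<Lambda> :: "(int ^ 'd::finite) set"
    and \<kappa> :: "'n::finite \<Rightarrow> int ^ 'd"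
    and p :: "complex ^ 'n"
  assumes "CARD('d) \<le> 2"
    and "finite \<Lambda>" and "0 \<in> \<Lambda>" and "uminus ` \<Lambda> = \<Lambda>"
    and "bij_betw \<kappa> UNIV \<Lambda>"
    and "p \<in> pos_cone \<kappa>"
  shows "diffeomorphism (herm_space \<kappa>) (pos_cone \<kappa>) (dual_cone \<kappa>) (moment_map \<kappa> p)"
proof -
  have range: "range \<kappa> = \<Lambda>" using assms(5) by (simp add: bij_betw_def)
  interpret moment_problem \<kappa> p
    by unfold_locales (use assms range in \<open>auto simp: bij_betw_def\<close>)
  obtain i where "\<kappa> i = 0" using assms(3) range by (metis imageE)
  with assms(1) show ?thesis by (rule diffeomorphism_moment_map)
qed

end
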